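(* Let $r\in[1,\infty)$, $\mathcal J=\mathcal F_c(\mathbb R^p)$, $\mathcal H_1\subseteq L^1[\mathcal F_c(\mathbb R^p)]$ and $\mathcal H_r\subseteq L^r[\mathcal F_c(\mathbb R^p)]$. Let $(D,\mathcal H)$ be either $(D_r,\mathcal H_1)$ or $(RD_r,\mathcal H_r)$. Then for every $\mathcal X\in\mathcal H$ and every $A\in\mathcal F_c(\mathbb R^p)$ with $D(A;\mathcal X)=\sup_{B\in\mathcal F_c(\mathbb R^p)}D(B;\mathcal X)$: (P3a) $D(A;\mathcal X)\ge D((1-\lambda)\cdot A+\lambda\cdot U;\mathcal X)\ge D(U;\mathcal X)$ for all $\lambda\in[0,1]$ and all $U\in\mathcal F_c(\mathbb R^p)$. (P4a) $\lim_{\lambda\to\infty}D(A+\lambda\cdot U;\mathcal X)=0$ for all $U\in\mathcal F_c(\mathbb R^p)\setminus\{\mathrm I_{\{0\}}\}$. (P3b) For each metric $d\in\{\rho_s,d_{s,\theta}\}$ with any $s\in(1,\infty)$ and any $\theta\in(0,\infty)$: $D(A;\mathcal X)\ge D(U;\mathcal X)\ge D(V;\mathcal X)$ for all $U,V\in\mathcal F_c(\mathbb R^p)$ satisfying $d(A,V)=d(A,U)+d(U,V)$. (P4b) For each metric $d\in\{\rho_s,d_{s,\theta}\}$ with any $s\in[1,r]$ and any $\theta\in(0,\infty)$: $\lim_{n\to\infty}D(A_n;\mathcal X)=0$ for every sequence $\{A_n\}_n$ in $\mathcal F_c(\mathbb R^p)$ with $d(A_n,A)\to\infty$.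
   Context: Fix an integer $p\ge1$; $\mathbb S^{p-1}=\{u\in\mathbb R^p:\|u\|=1\}$ with $\|\cdot\|$ the Euclidean norm. For $A:\mathbb R^p\to[0,1]$ the $\alpha$-levels are $A_\alpha=\{x:A(x)\ge\alpha\}$ for $\alpha\in(0,1]$, and $A_0$ is the closure of $\{x:A(x)>0\}$. $\mathcal F_c(\mathbb R^p)$ is the set of all $A:\mathbb R^p\to[0,1]$ such that $A_\alpha$ is non-empty, compact and convex for each $\alpha\in[0,1]$. $\mathcal K_c(\mathbb R^p)$ is the class of non-empty compact convex subsets of $\mathbb R^p$; $\|K\|=\max_{x\in K}\|x\|$ for $K\in\mathcal K_c(\mathbb R^p)$; $\mathrm I_K$ is the indicator function of $K$. Operations: $(A+B)(t)=\sup_{x+y=t}\min\{A(x),B(y)\}$ and $(\gamma\cdot A)(t)=\sup\{A(x):\gamma x=t\}$ for $\gamma\in\mathbb R$ (so $0\cdot A=\mathrm I_{\{0\}}$). The support function of $A$ is $s_A(u,\alpha)=\sup_{v\in A_\alpha}\langle u,v\rangle$, $(u,\alpha)\in\mathbb S^{p-1}\times[0,1]$; its mid and spread are $\mathrm{mid}(s_A)(u,\alpha)=(s_A(u,\alpha)-s_A(-u,\alpha))/2$ and $\mathrm{spr}(s_A)(u,\alpha)=(s_A(u,\alpha)+s_A(-u,\alpha))/2$. With $\mathcal V_p$ the normalized Haar (uniform probability) measure on $\mathbb S^{p-1}$, $\nu$ the Lebesgue measure on $[0,1]$ and $\|\cdot\|_r$ the norm of $L^r(\mathbb S^{p-1}\times[0,1],\mathcal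 V_p\otimes\nu)$, set for $r\in[1,\infty)$: $\rho_r(A,B)=\|s_A-s_B\|_r$ and, for $\theta\ge0$, $d_{r,\theta}(A,B)=\left[\|\mathrm{mid}(s_A)-\mathrm{mid}(s_B)\|_r^r+\theta\|\mathrm{spr}(s_A)-\mathrm{spr}(s_B)\|_r^r\right]^{1/r}$. Given a probability space $(\Omega,\mathcal A,\mathbb P)$, a map $\mathcal X:\Omega\to\mathcal F_c(\mathbb R^p)$ is a fuzzy random variable if for every $\alpha\in[0,1]$ the map $\omega\mapsto\mathcal X_\alpha(\omega)=\mathcal X(\omega)_\alpha\in\mathcal K_c(\mathbb R^p)$ is Borel measurable with respect to the Hausdorff metric. For $r\in[1,\infty)$, $L^r[\mathcal F_c(\mathbb R^p)]$ is the class of fuzzy random variables with $\mathrm E[\|\mathcal X_0\|^r]<\infty$. The $r$-natural depth is $D_r(A;\mathcal X)=(1+\mathrm E[\rho_r(A,\mathcal X)])^{-1}$ and the $r$-natural raised depth is $RD_r(A;\mathcal X)=(1+\mathrm E[\rho_r(A,\mathcal X)^r])^{-1}$. *)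

theory Defs
  imports "HOL-Probability.Probability"
begin

section \<open>Fuzzy sets\<close>

type_synonym 'n fuzzy = "real^'n \<Rightarrow> real"

definition level :: "'n::finite fuzzy \<Rightarrow> real \<Rightarrow> (real^'n) set" where
  "level A \<alpha> = (if \<alpha> = 0 then closure {x. A x > 0} else {x. A x \<ge> \<alpha>})"

definition Kc :: "(real^'n::finite) set set" where
  "Kc = {K. K \<noteq> {} \<and> compact K \<and> convex K}"

definition Fc :: "'n::finite fuzzy set" where
  "Fc = {A. (\<forall>x. A x \<in> {0..1}) \<and> (\<forall>\<alpha>\<in>{0..1}. level A \<alpha> \<in> Kc)}"

definition set_mag :: "(real^'n::finite) set \<Rightarrow> real" where
  "set_mag K = (SUP x\<in>K. norm x)"

definition fuzzy_add :: "'n::finite fuzzy \<Rightarrow> 'n fuzzy \<Rightarrow> 'n fuzzy" (infixl "\<oplus>\<^sub>F" 65) where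
  "A \<oplus>\<^sub>F B = (\<lambda>t. Sup {min (A x) (B y) | x y. x + y = t})"

text \<open>The supremum is taken in \<open>[0,1]\<close>, so that the supremum of the empty set is 0; inserting 0
  has this effect and changes nothing otherwise. In particular \<open>0 \<odot>\<^sub>F A\<close> is the indicator of
  \<open>{0}\<close>.\<close>

definition fuzzy_scale :: "real \<Rightarrow> 'n::finite fuzzy \<Rightarrow> 'n fuzzy" (infixr "\<odot>\<^sub>F" 75) where
  "\<gamma> \<odot>\<^sub>F A = (\<lambda>t. Sup (insert 0 {A x | x. \<gamma> *\<^sub>R x = t}))"


section \<open>Support functions\<close>

definition supp_fun :: "'n::finite fuzzy \<Rightarrow> (real^'n) \<times> real \<Rightarrow> real" where
  "supp_fun A = (\<lambda>(u, \<alpha>). SUP v\<in>level A \<alpha>. u \<bullet> v)"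

definition mid :: "((real^'n::finite) \<times> real \<Rightarrow> real) \<Rightarrow> (real^'n) \<times> real \<Rightarrow> real" where
  "mid s = (\<lambda>(u, \<alpha>). (s (u, \<alpha>) - s (- u, \<alpha>)) / 2)"

definition spr :: "((real^'n::finite) \<times> real \<Rightarrow> real) \<Rightarrow> (real^'n) \<times> real \<Rightarrow> real" where
  "spr s = (\<lambda>(u, \<alpha>). (s (u, \<alpha>) + s (- u, \<alpha>)) / 2)"


section \<open>The uniform probability measure on the unit sphere\<close>

text \<open>The uniform distribution on the sphere is obtained as the
  law of the direction of a uniformly distributed point of the unit ball; \<open>sgn x\<close> is \<open>x / norm x\<close>,
  and the origin, where it is 0, is a null set. The lemmas below show that the result is
  a Borel probability measure on the sphere that is invariant under all orthogonal transformations,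
  which characterizes the normalized Haar measure.\<close>

definition sphere_measure :: "(real^'n::finite) measure" where
  "sphere_measure =
     restrict_space (distr (uniform_measure lborel (ball 0 1)) borel sgn) (sphere 0 1)"

lemma space_sphere_measure: "space sphere_measure = sphere 0 1"
  by (simp add: sphere_measure_def space_restrict_space)

lemma sets_sphere_measure: "sets sphere_measure = sets (restrict_space borel (sphere 0 1))"
  by (simp add: sphere_measure_def sets_restrict_space)

lemma emeasure_sphere_measure:
  fixes B :: "(real^'n::finite) set"
  assumes "B \<in> sets borel" "B \<subseteq> sphere 0 1"
  shows "emeasure sphere_measure B =
    emeasure lborel (ball 0 1 \<inter> sgn -` B) / emeasure lborel (ball 0 1 :: (real^'n) set)"
proof -
  have [measurable]: "(sgn :: real^'n \<Rightarrow> real^'n) \<in> borel_measurable borel"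
    unfolding sgn_div_norm by measurable
  have m: "sgn -` B \<in> sets borel"
    using measurable_sets[of "sgn :: real^'n \<Rightarrow> real^'n" borel borel B] assms by simp
  have "emeasure sphere_measure B
      = emeasure (distr (uniform_measure lborel (ball 0 1 :: (real^'n) set)) borel sgn) B"
    unfolding sphere_measure_def using assms by (subst emeasure_restrict_space) auto
  also have "\<dots> = emeasure (uniform_measure lborel (ball 0 1)) (sgn -` B)"
    using assms by (subst emeasure_distr) auto
  also have "\<dots> = emeasure lborel (ball 0 1 \<inter> sgn -` B) / emeasure lborel (ball 0 1 :: (real^'n) set)"
    using m by (subst emeasure_uniform_measure) auto
  finally show ?thesis .
qed

lemma emeasure_unit_ball:
  "emeasure lborel (ball 0 1 :: (real^'n::finite) set) \<noteq> 0"
  "emeasure lborel (ball 0 1 :: (real^'n) set) \<noteq> \<infinity>"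
proof -
  have "unit_ball_vol (real CARD('n)) > 0"
    by (rule unit_ball_vol_pos) simp
  then show "emeasure lborel (ball 0 1 :: (real^'n) set) \<noteq> 0"
    by (simp add: emeasure_ball ennreal_eq_0_iff not_le)
  show "emeasure lborel (ball 0 1 :: (real^'n) set) \<noteq> \<infinity>"
    using emeasure_lborel_ball_finite[of "0::real^'n" 1] by simp
qed

lemma prob_space_sphere_measure: "prob_space (sphere_measure :: (real^'n::finite) measure)"
proof
  have "ball 0 1 \<inter> sgn -` sphere 0 1 = (ball 0 1 :: (real^'n) set) - {0}"
    by (auto simp: norm_sgn split: if_splits)
  moreover have "emeasure lborel (ball 0 1 - {0} :: (real^'n) set) = emeasure lborel (ball 0 1 :: (real^'n) set)"
    by (intro emeasure_Diff_null_set) auto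
  ultimately show "emeasure sphere_measure (space (sphere_measure :: (real^'n) measure)) = 1"
    using emeasure_unit_ball[where 'n='n]
    by (simp add: space_sphere_measure emeasure_sphere_measure less_top)
qed

lemma distr_lborel_orthogonal:
  fixes f :: "real^'n::finite \<Rightarrow> real^'n"
  assumes f: "orthogonal_transformation f"
  shows "distr lborel borel f = lborel"
proof (rule measure_eqI)
  fix B assume "B \<in> sets (distr lborel borel f)"
  then have [measurable]: "B \<in> sets borel" by simp
  have lin: "linear f" and [measurable]: "f \<in> borel_measurable borel"
    using orthogonal_transformation_linear[OF f]
    by (auto simp: linear_conv_bounded_linear
        intro!: borel_measurable_continuous_onI linear_continuous_on)
  define E where "E = (ball 0 1 :: (real^'n) set)"
  have [measurable]: "E \<in> sets borel" by (simp add: E_def)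
  have fE: "f -` E = E"
    using f by (auto simp: E_def orthogonal_transformation)
  have trans: "(\<integral>\<^sup>+x. h (x + c) \<partial>lborel) = (\<integral>\<^sup>+x. h x \<partial>lborel)"
    if [measurable]: "h \<in> borel_measurable borel" for h and c :: "real^'n"
    by (subst (2) lborel_distr_plus[of c, symmetric])
      (simp add: nn_integral_distr add.commute)
  have refl: "(\<integral>\<^sup>+x. h (c - x) \<partial>lborel) = (\<integral>\<^sup>+x. h x \<partial>lborel)"
    if [measurable]: "h \<in> borel_measurable borel" for h and c :: "real^'n"
    by (subst (2) lborel_affine[of "-1" c]) (simp_all add: nn_integral_distr nn_integral_density)
  have "emeasure lborel B * emeasure lborel E =
      (\<integral>\<^sup>+y. (\<integral>\<^sup>+x. indicator E (f y) * indicator B (x + f y) \<partial>lborel) \<partial>lborel)"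
  proof -
    have "(\<integral>\<^sup>+x. indicator B (x + f y) \<partial>lborel) = emeasure lborel B" for y
      by (subst trans) simp_all
    moreover have "(\<integral>\<^sup>+y. indicator E (f y) \<partial>lborel) = emeasure lborel E"
      by (simp add: indicator_vimage[symmetric] fE)
    ultimately show ?thesis
      by (simp add: nn_integral_cmult nn_integral_multc mult.commute)
  qed
  also have "\<dots> = (\<integral>\<^sup>+x. (\<integral>\<^sup>+y. indicator E (f y) * indicator B (x + f y) \<partial>lborel) \<partial>lborel)"
    by (rule lborel_pair.Fubini') measurable
  also have "\<dots> = (\<integral>\<^sup>+x. (\<integral>\<^sup>+y. indicator E (f y - x) * indicator B (f y) \<partial>lborel) \<partial>lborel)"
  proof (rule nn_integral_cong)
    fix x :: "real^'n"
    obtain z where z: "f z = x"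
      using orthogonal_transformation_surj[OF f] by (metis surjD)
    show "(\<integral>\<^sup>+y. indicator E (f y) * indicator B (x + f y) \<partial>lborel) =
        (\<integral>\<^sup>+y. indicator E (f y - x) * indicator B (f y) \<partial>(lborel :: (real^'n) measure))"
      using trans[of "\<lambda>y. indicator E (f y - x) * indicator B (f y)" z]
      by (simp add: linear_add[OF lin] z add.commute)
  qed
  also have "\<dots> = (\<integral>\<^sup>+y. (\<integral>\<^sup>+x. indicator E (f y - x) * indicator B (f y) \<partial>lborel) \<partial>lborel)"
    by (rule lborel_pair.Fubini') measurable
  also have "\<dots> = emeasure lborel (f -` B) * emeasure lborel E"
  proof -
    have "(\<integral>\<^sup>+x. indicator E (f y - x) \<partial>lborel) = emeasure lborel E" for y
      by (subst refl) simp_all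
    moreover have "f -` B \<in> sets borel"
      using measurable_sets[of f borel borel B] by simp
    ultimately show ?thesis
      by (simp add: nn_integral_cmult nn_integral_multc mult.commute indicator_vimage[symmetric])
  qed
  finally have "emeasure lborel B = emeasure lborel (f -` B)"
    using emeasure_unit_ball[where 'n='n]
    by (auto simp: E_def ennreal_mult_cancel_left mult.commute[of _ "emeasure lborel (ball 0 1)"])
  then show "emeasure (distr lborel borel f) B = emeasure lborel B"
    by (simp add: emeasure_distr)
qed simp

lemma distr_sphere_measure_orthogonal:
  fixes f :: "real^'n::finite \<Rightarrow> real^'n"
  assumes f: "orthogonal_transformation f"
  shows "distr sphere_measure sphere_measure f = sphere_measure"
proof (rule measure_eqI)
  fix B assume "B \<in> sets (distr sphere_measure sphere_measure f)"
  then have B: "B \<in> sets borel" "B \<subseteq> sphere 0 1"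
    by (auto simp: sets_sphere_measure sets_restrict_space)
  have [measurable]: "f \<in> borel_measurable borel" "(sgn :: real^'n \<Rightarrow> real^'n) \<in> borel_measurable borel"
    using orthogonal_transformation_linear[OF f]
    by (auto simp: sgn_div_norm linear_conv_bounded_linear
        intro!: borel_measurable_continuous_onI linear_continuous_on)
  have fm: "f \<in> measurable sphere_measure sphere_measure"
    using f unfolding sphere_measure_def
    by (intro measurable_restrict_space3) (auto simp: orthogonal_transformation)
  have sgnf: "sgn (f x) = f (sgn x)" for x
    using f by (simp add: sgn_div_norm orthogonal_transformation linear_scale)
  have fB: "f -` B \<in> sets borel" "f -` B \<subseteq> sphere 0 1"
    using measurable_sets[of f borel borel B] B f by (auto simp: orthogonal_transformation)
  have S: "ball 0 1 \<inter> sgn -` B \<in> sets borel"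
    using measurable_sets[of "sgn :: real^'n \<Rightarrow> real^'n" borel borel B] B by simp
  have "ball 0 1 \<inter> sgn -` (f -` B) = f -` (ball 0 1 \<inter> sgn -` B)"
    using f by (auto simp: orthogonal_transformation sgnf)
  then have "emeasure lborel (ball 0 1 \<inter> sgn -` (f -` B)) =
      emeasure (distr lborel borel f) (ball 0 1 \<inter> sgn -` B)"
    using S by (simp add: emeasure_distr)
  then have "emeasure sphere_measure (f -` B) = emeasure sphere_measure B"
    using B fB by (simp add: emeasure_sphere_measure distr_lborel_orthogonal[OF f])
  moreover have "f -` B \<inter> sphere 0 1 = f -` B"
    using fB by auto
  ultimately show "emeasure (distr sphere_measure sphere_measure f) B = emeasure sphere_measure B"
    using fm B by (simp add: emeasure_distr space_sphere_measure sets_sphere_measure sets_restrict_space_iff)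
qed simp


section \<open>Distances between fuzzy sets\<close>

definition Lnorm :: "real \<Rightarrow> ((real^'n::finite) \<times> real \<Rightarrow> real) \<Rightarrow> real" where
  "Lnorm r f =
     (\<integral>z. \<bar>f z\<bar> powr r \<partial>(sphere_measure \<Otimes>\<^sub>M restrict_space lborel {0..1})) powr (1 / r)"

definition rho :: "real \<Rightarrow> 'n::finite fuzzy \<Rightarrow> 'n fuzzy \<Rightarrow> real" where
  "rho r A B = Lnorm r (\<lambda>z. supp_fun A z - supp_fun B z)"

definition dmetric :: "real \<Rightarrow> real \<Rightarrow> 'n::finite fuzzy \<Rightarrow> 'n fuzzy \<Rightarrow> real" where
  "dmetric r \<theta> A B =
     (Lnorm r (\<lambda>z. mid (supp_fun A) z - mid (supp_fun B) z) powr r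
       + \<theta> * Lnorm r (\<lambda>z. spr (supp_fun A) z - spr (supp_fun B) z) powr r) powr (1 / r)"


section \<open>Fuzzy random variables\<close>

text \<open>The locale \<open>Metric_space\<close> asks for non-negativity and symmetry also off the carrier, where the
  suprema need not exist; hence the default value 0 there.\<close>

definition hausdorff :: "(real^'n::finite) set \<Rightarrow> (real^'n) set \<Rightarrow> real" where
  "hausdorff K L =
     (if K \<in> Kc \<and> L \<in> Kc then max (SUP x\<in>K. infdist x L) (SUP y\<in>L. infdist y K) else 0)"

lemma Metric_space_hausdorff: "Metric_space (Kc :: (real^'n::finite) set set) hausdorff"
proof
  have bdd: "bdd_above ((\<lambda>x. infdist x L) ` K)" if "K \<in> Kc" for K L :: "(real^'n) set"
    using that by (intro bounded_imp_bdd_above compact_imp_bounded compact_continuous_image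
        continuous_on_infdist) (auto simp: Kc_def)
  have ne: "K \<noteq> {}" if "K \<in> Kc" for K :: "(real^'n) set"
    using that by (simp add: Kc_def)
  have le: "hausdorff K L \<le> e \<longleftrightarrow> (\<forall>x\<in>K. infdist x L \<le> e) \<and> (\<forall>y\<in>L. infdist y K \<le> e)"
    if "K \<in> Kc" "L \<in> Kc" for K L :: "(real^'n) set" and e
  proof -
    have "hausdorff K L \<le> e \<longleftrightarrow> (SUP x\<in>K. infdist x L) \<le> e \<and> (SUP y\<in>L. infdist y K) \<le> e"
      using that by (simp add: hausdorff_def)
    also have "\<dots> \<longleftrightarrow> (\<forall>x\<in>K. infdist x L \<le> e) \<and> (\<forall>y\<in>L. infdist y K \<le> e)"
      using that by (simp add: cSUP_le_iff bdd ne)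
    finally show ?thesis .
  qed
  show nn: "0 \<le> hausdorff K L" for K L :: "(real^'n) set"
  proof (cases "K \<in> Kc \<and> L \<in> Kc")
    case True
    then obtain x where "x \<in> K" by (auto simp: Kc_def)
    then show ?thesis
      using le[of K L "hausdorff K L"] True infdist_nonneg[of x L] by fastforce
  qed (auto simp: hausdorff_def)
  show "hausdorff K L = hausdorff L K" for K L :: "(real^'n) set"
    by (auto simp: hausdorff_def max.commute)
  show "hausdorff K L = 0 \<longleftrightarrow> K = L" if K: "K \<in> Kc" and L: "L \<in> Kc" for K L :: "(real^'n) set"
  proof -
    have "closed K" "closed L" "K \<noteq> {}" "L \<noteq> {}"
      using K L by (auto simp: Kc_def compact_imp_closed)
    then have "infdist x K \<le> 0 \<longleftrightarrow> x \<in> K" "infdist x L \<le> 0 \<longleftrightarrow> x \<in> L" for x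
      using infdist_nonneg[of x K] infdist_nonneg[of x L] by (auto simp: in_closed_iff_infdist_zero)
    then have "hausdorff K L \<le> 0 \<longleftrightarrow> K = L"
      by (auto simp: le[OF K L])
    moreover have "hausdorff K L = 0 \<longleftrightarrow> hausdorff K L \<le> 0"
      using nn[of K L] by linarith
    ultimately show ?thesis by simp
  qed
  show "hausdorff K M \<le> hausdorff K L + hausdorff L M"
    if K: "K \<in> Kc" and L: "L \<in> Kc" and M: "M \<in> Kc" for K L M :: "(real^'n) set"
  proof -
    have *: "infdist x M \<le> a + b"
      if L: "L \<in> Kc" and "infdist x L \<le> a" "\<forall>y\<in>L. infdist y M \<le> b"
      for x and L M :: "(real^'n) set" and a b
    proof -
      obtain y where "y \<in> L" "infdist x L = dist x y"
        using infdist_attains_inf[of L x] L by (auto simp: Kc_def compact_imp_closed)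
      then show ?thesis
        using infdist_triangle[of x M y] that by fastforce
    qed
    have "\<forall>x\<in>K. infdist x L \<le> hausdorff K L" "\<forall>y\<in>L. infdist y K \<le> hausdorff K L"
      "\<forall>x\<in>L. infdist x M \<le> hausdorff L M" "\<forall>y\<in>M. infdist y L \<le> hausdorff L M"
      using le[OF K L, of "hausdorff K L"] le[OF L M, of "hausdorff L M"] by auto
    then show ?thesis
      using *[OF L, of _ "hausdorff K L" M "hausdorff L M"]
        *[OF L, of _ "hausdorff L M" K "hausdorff K L"]
      by (simp add: le[OF K M] add.commute)
  qed
qed

definition hausdorff_borel :: "(real^'n::finite) set measure" where
  "hausdorff_borel = sigma Kc {U. openin (Metric_space.mtopology Kc hausdorff) U}"

definition fuzzy_rv :: "'w measure \<Rightarrow> ('w \<Rightarrow> 'n::finite fuzzy) \<Rightarrow> bool" where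
  "fuzzy_rv P X \<longleftrightarrow> X \<in> space P \<rightarrow> Fc \<and>
     (\<forall>\<alpha>\<in>{0..1}. (\<lambda>\<omega>. level (X \<omega>) \<alpha>) \<in> P \<rightarrow>\<^sub>M hausdorff_borel)"

definition Lr_fuzzy :: "'w measure \<Rightarrow> real \<Rightarrow> ('w \<Rightarrow> 'n::finite fuzzy) set" where
  "Lr_fuzzy P r = {X. fuzzy_rv P X \<and> integrable P (\<lambda>\<omega>. set_mag (level (X \<omega>) 0) powr r)}"


section \<open>Depth functions\<close>

definition natural_depth ::
  "'w measure \<Rightarrow> real \<Rightarrow> 'n::finite fuzzy \<Rightarrow> ('w \<Rightarrow> 'n fuzzy) \<Rightarrow> real" where
  "natural_depth P r A X = inverse (1 + (\<integral>\<omega>. rho r A (X \<omega>) \<partial>P))"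

definition natural_raised_depth ::
  "'w measure \<Rightarrow> real \<Rightarrow> 'n::finite fuzzy \<Rightarrow> ('w \<Rightarrow> 'n fuzzy) \<Rightarrow> real" where
  "natural_raised_depth P r A X = inverse (1 + (\<integral>\<omega>. rho r A (X \<omega>) powr r \<partial>P))"

end

theory Submission
  imports Defs
begin

text \<open>
  Both depths have the form \<open>D B X = 1 / (1 + C B)\<close>, where the cost \<open>C B\<close> is the mean of
  \<open>rho r B X\<close> or of its power \<open>r\<close>. A set of maximal depth is a set of minimal cost, and all four
  properties follow from two facts about \<open>C\<close> (\<open>depth_of_convex_coercive_cost\<close>).

  Convexity: the map that sends a fuzzy set to its support function turns \<open>(1 - t) \<odot>\<^sub>F A \<oplus>\<^sub>F t \<odot>\<^sub>F V\<close>
  into the convex combination of the support functions. So if \<open>W\<close> lies between \<open>A\<close> and \<open>V\<close> in the sense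
  that \<open>supp_fun W = (1 - t) * supp_fun A + t * supp_fun V\<close> almost everywhere, then
  \<open>C W \<le> (1 - t) * C A + t * C V\<close> by the Minkowski inequality (\<open>rho_convex\<close>). If \<open>A\<close> minimises \<open>C\<close>, this
  gives \<open>C A \<le> C W \<le> C V\<close>, which is the monotonicity along segments. The monotonicity along metric
  segments is the same statement: for an exponent \<open>s > 1\<close> the space \<open>L\<^sup>s\<close> is strictly convex, so
  \<open>d A V = d A U + d U V\<close> forces the support function of \<open>U\<close> to be a convex combination of
  those of \<open>A\<close> and \<open>V\<close> almost everywhere (\<open>metric_segment\<close>).

  Coercivity: by the triangle inequality, \<open>rho r B A \<le> C B + K\<close> with a constant \<open>K\<close> that does not depend
  on \<open>B\<close>. So the depth vanishes along every family that goes to infinity in \<open>rho r\<close>. That is the case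
  for \<open>A \<oplus>\<^sub>F t \<odot>\<^sub>F U\<close>, since \<open>rho r (A \<oplus>\<^sub>F t \<odot>\<^sub>F U) A\<close> is \<open>t\<close> times the norm of the support function
  of \<open>U\<close>, and this norm is positive unless \<open>U\<close> is the indicator of the origin
  (\<open>Lnorm_supp_fun_pos\<close>). It is also the case for every sequence that goes to infinity in one of the
  other metrics with exponent \<open>s \<le> r\<close>, as these are bounded in terms of \<open>rho r\<close> (\<open>metric_le_rho\<close>).

  A Bochner integral of a function that is not integrable is 0 and would turn an infinite cost
  into the depth 1. Integrability of the costs is therefore part of the proof; its substance is
  the joint measurability of the support function of a fuzzy random variable in the random parameter,
  the direction and the level (\<open>measurable_supp_fun\<close>).
\<close>

section \<open>The function \<open>\<bar>x\<bar> powr s\<close> and the Minkowski inequality\<close>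

text \<open>Bernoulli's inequality for real exponents, in its strict form. It is the tangent of \<open>x powr s\<close> at 1;
  the tangents elsewhere follow by scaling.\<close>
lemma powr_above_tangent_at_1:
  fixes x s :: real
  assumes "1 < s" "0 \<le> x" "x \<noteq> 1"
  shows "1 + s * (x - 1) < x powr s"
proof (cases "x = 0")
  case False
  with assms have x: "0 < x" by simp
  have D: "((\<lambda>y. y powr s) has_real_derivative s * y powr (s - 1)) (at y)" if "0 < y" for y
    using that by (rule has_real_derivative_powr)
  consider "1 < x" | "x < 1" using assms by linarith
  then show ?thesis
  proof cases
    case 1
    obtain z where z: "1 < z" "z < x" "x powr s - 1 powr s = (x - 1) * (s * z powr (s - 1))"
      using MVT2[OF 1, of "\<lambda>y. y powr s" "\<lambda>y. s * y powr (s - 1)"] D by auto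
    have "1 < z powr (s - 1)"
      using powr_less_mono2[of "s - 1" 1 z] z assms by simp
    then have "(x - 1) * (s * 1) < (x - 1) * (s * z powr (s - 1))"
      using 1 assms by (intro mult_strict_left_mono) auto
    then show ?thesis using z by (simp add: algebra_simps)
  next
    case 2
    obtain z where z: "x < z" "z < 1" "1 powr s - x powr s = (1 - x) * (s * z powr (s - 1))"
      using MVT2[OF 2, of "\<lambda>y. y powr s" "\<lambda>y. s * y powr (s - 1)"] D x by auto
    have "z powr (s - 1) < 1"
      using powr_less_mono2[of "s - 1" z 1] z assms x by simp
    then have "(1 - x) * (s * z powr (s - 1)) < (1 - x) * (s * 1)"
      using 2 assms by (intro mult_strict_left_mono) auto
    then show ?thesis using z by (simp add: algebra_simps)
  qed
qed (use assms in auto)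

text \<open>Strict convexity in the form of a supporting line. At \<open>m = 0\<close> the slope is 0, because of the factor
  \<open>sgn m\<close>. For \<open>m \<noteq> 0\<close> everything is reduced to the half-line of positive numbers
  by \<open>sgn m * x \<le> \<bar>x\<bar>\<close>; the point \<open>x = - m\<close>, where \<open>\<bar>x\<bar> = \<bar>m\<bar>\<close>, is the only one at which strictness is not
  inherited from there, and it has \<open>sgn m * x < \<bar>x\<bar>\<close>.\<close>
lemma abs_powr_above_tangent:
  fixes x m s :: real
  assumes "1 < s" "x \<noteq> m"
  shows "\<bar>m\<bar> powr s + s * \<bar>m\<bar> powr (s - 1) * sgn m * (x - m) < \<bar>x\<bar> powr s"
proof (cases "m = 0")
  case False
  define c where "c = \<bar>m\<bar>"
  have c: "0 < c" using False by (simp add: c_def)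
  have cs: "c powr s = c powr (s - 1) * c"
    using c by (simp add: powr_diff)
  have tangent: "c powr s + s * c powr (s - 1) * (y - c) < y powr s" if "0 \<le> y" "y \<noteq> c" for y
  proof -
    have "1 + s * (y / c - 1) < (y / c) powr s"
      using that assms c by (intro powr_above_tangent_at_1) (auto simp: field_simps)
    then have "c powr s * (1 + s * (y / c - 1)) < c powr s * (y / c) powr s"
      using c by (intro mult_strict_left_mono) auto
    also have "\<dots> = y powr s"
      using that c by (simp add: powr_divide)
    also have "c powr s * (1 + s * (y / c - 1)) = c powr s + s * c powr (s - 1) * (y - c)"
      unfolding cs using c by (simp add: field_simps)
    finally show ?thesis .
  qed
  have eq: "sgn m * (x - m) = sgn m * x - c"
    by (simp add: c_def algebra_simps abs_sgn)
  show ?thesis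
  proof (cases "\<bar>x\<bar> = c")
    case True
    with assms have "x = - m" using c_def by linarith
    then have "sgn m * (x - m) < \<bar>x\<bar> - c"
      using False True c by (simp add: eq c_def[symmetric] abs_sgn[symmetric] mult.commute)
    then have "s * c powr (s - 1) * (sgn m * (x - m)) < s * c powr (s - 1) * (\<bar>x\<bar> - c)"
      using assms c by (intro mult_strict_left_mono) auto
    then show ?thesis using True by (simp add: c_def mult.assoc)
  next
    case F: False
    have "sgn m * x \<le> \<bar>x\<bar>" by (auto simp: sgn_if)
    then have "s * c powr (s - 1) * (sgn m * (x - m)) \<le> s * c powr (s - 1) * (\<bar>x\<bar> - c)"
      unfolding eq using assms c by (intro mult_left_mono) auto
    with tangent[of "\<bar>x\<bar>"] F show ?thesis by (simp add: c_def mult.assoc)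
  qed
qed (use assms in auto)

text \<open>Both this and the equality case come from adding, with weights \<open>1 - t\<close> and \<open>t\<close>, the supporting line
  at the intermediate point \<open>m\<close>, evaluated at \<open>x\<close> and \<open>y\<close>: the linear terms cancel.\<close>
lemma abs_powr_convex:
  fixes x y s t :: real
  assumes s: "1 \<le> s" and t: "0 \<le> t" "t \<le> 1"
  shows "\<bar>(1 - t) * x + t * y\<bar> powr s \<le> (1 - t) * \<bar>x\<bar> powr s + t * \<bar>y\<bar> powr s"
proof (cases "s = 1")
  case True
  have "\<bar>(1 - t) * x + t * y\<bar> \<le> \<bar>(1 - t) * x\<bar> + \<bar>t * y\<bar>" by (rule abs_triangle_ineq)
  with True t show ?thesis by (simp add: abs_mult)
next
  case False
  define m where "m = (1 - t) * x + t * y"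
  define g where "g = s * \<bar>m\<bar> powr (s - 1) * sgn m"
  have le: "\<bar>m\<bar> powr s + g * (z - m) \<le> \<bar>z\<bar> powr s" for z
    using abs_powr_above_tangent[of s z m] s False by (cases "z = m") (auto simp: g_def)
  have "\<bar>m\<bar> powr s = (1 - t) * (\<bar>m\<bar> powr s + g * (x - m)) + t * (\<bar>m\<bar> powr s + g * (y - m))"
    by (simp add: m_def algebra_simps)
  also have "\<dots> \<le> (1 - t) * \<bar>x\<bar> powr s + t * \<bar>y\<bar> powr s"
    using t by (intro add_mono mult_left_mono le) auto
  finally show ?thesis by (simp add: m_def)
qed

lemma abs_powr_convex_eq:
  fixes x y s t :: real
  assumes s: "1 < s" and t: "0 < t" "t < 1"
    and eq: "\<bar>(1 - t) * x + t * y\<bar> powr s = (1 - t) * \<bar>x\<bar> powr s + t * \<bar>y\<bar> powr s"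
  shows "x = y"
proof (rule ccontr)
  assume "x \<noteq> y"
  define m where "m = (1 - t) * x + t * y"
  define g where "g = s * \<bar>m\<bar> powr (s - 1) * sgn m"
  have ne: "x \<noteq> m" "y \<noteq> m"
  proof -
    have "x - m = t * (x - y)" "m - y = (1 - t) * (x - y)" by (simp_all add: m_def algebra_simps)
    with \<open>x \<noteq> y\<close> t show "x \<noteq> m" "y \<noteq> m" by auto
  qed
  have "\<bar>m\<bar> powr s = (1 - t) * (\<bar>m\<bar> powr s + g * (x - m)) + t * (\<bar>m\<bar> powr s + g * (y - m))"
    by (simp add: m_def algebra_simps)
  also have "\<dots> < (1 - t) * \<bar>x\<bar> powr s + t * \<bar>y\<bar> powr s"
    using t ne abs_powr_above_tangent[of s _ m] s
    by (intro add_strict_mono mult_strict_left_mono) (auto simp: g_def)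
  finally show False using eq by (simp add: m_def)
qed

lemma powr_le_one_plus_powr:
  fixes x s r :: real
  assumes "0 \<le> s" "s \<le> r" "0 \<le> x"
  shows "x powr s \<le> 1 + x powr r"
proof (cases "x \<le> 1")
  case True
  then have "x powr s \<le> 1" using assms powr_mono2[of s x 1] by simp
  then show ?thesis by (simp add: add_increasing2)
next
  case False
  then have "x powr s \<le> x powr r" using assms by (intro powr_mono) auto
  then show ?thesis by simp
qed

lemma integrable_abs_powr_lincomb:
  fixes f g :: "'a \<Rightarrow> real"
  assumes s: "1 \<le> s" and [measurable]: "f \<in> borel_measurable M" "g \<in> borel_measurable M"
    and f: "integrable M (\<lambda>z. \<bar>f z\<bar> powr s)" and g: "integrable M (\<lambda>z. \<bar>g z\<bar> powr s)"
  shows "integrable M (\<lambda>z. \<bar>a * f z + b * g z\<bar> powr s)"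
proof (rule Bochner_Integration.integrable_bound)
  show "integrable M (\<lambda>z. 1/2 * (\<bar>2 * a\<bar> powr s * \<bar>f z\<bar> powr s) + 1/2 * (\<bar>2 * b\<bar> powr s * \<bar>g z\<bar> powr s))"
    using f g by simp
  have "\<bar>a * f z + b * g z\<bar> powr s
      \<le> 1/2 * (\<bar>2 * a\<bar> powr s * \<bar>f z\<bar> powr s) + 1/2 * (\<bar>2 * b\<bar> powr s * \<bar>g z\<bar> powr s)" for z
    using abs_powr_convex[of s "1/2" "2 * a * f z" "2 * b * g z"] s
    by (simp add: powr_mult[symmetric] abs_mult[symmetric] mult.assoc)
  then show "AE z in M. norm (\<bar>a * f z + b * g z\<bar> powr s)
      \<le> norm (1/2 * (\<bar>2 * a\<bar> powr s * \<bar>f z\<bar> powr s) + 1/2 * (\<bar>2 * b\<bar> powr s * \<bar>g z\<bar> powr s))"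
    by (intro AE_I2) (smt (verit) norm_ge_zero powr_ge_zero real_norm_def)
qed measurable

lemma integral_abs_powr_scale:
  fixes f :: "'a \<Rightarrow> real"
  shows "(\<integral>z. \<bar>c * f z\<bar> powr s \<partial>M) = \<bar>c\<bar> powr s * (\<integral>z. \<bar>f z\<bar> powr s \<partial>M)"
  by (simp add: abs_mult powr_mult)

text \<open>For numbers \<open>a\<close> and \<open>b\<close> that exceed the two norms, \<open>(f + g) / (a + b)\<close> is a convex combination of
  \<open>f / a\<close> and \<open>g / b\<close>, which have norm at most 1; integrate \<open>abs_powr_convex\<close>. Taking \<open>a\<close> and \<open>b\<close>
  strictly larger than the norms avoids the case of a norm that is 0.\<close>
lemma Minkowski_inequality:
  fixes f g :: "'a \<Rightarrow> real"
  assumes s: "1 \<le> s" and [measurable]: "f \<in> borel_measurable M" "g \<in> borel_measurable M"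
    and f: "integrable M (\<lambda>z. \<bar>f z\<bar> powr s)" and g: "integrable M (\<lambda>z. \<bar>g z\<bar> powr s)"
  shows "(\<integral>z. \<bar>f z + g z\<bar> powr s \<partial>M) powr (1 / s)
    \<le> (\<integral>z. \<bar>f z\<bar> powr s \<partial>M) powr (1 / s) + (\<integral>z. \<bar>g z\<bar> powr s \<partial>M) powr (1 / s)"
    (is "?N \<le> ?a + ?b")
proof (rule field_le_epsilon)
  fix e :: real assume e: "0 < e"
  define a b t where "a = ?a + e / 2" and "b = ?b + e / 2" and "t = b / (a + b)"
  have ab: "0 < a" "0 < b"
    using e by (simp_all add: a_def b_def add_nonneg_pos)
  have t: "0 \<le> t" "t \<le> 1" and t1: "1 - t = a / (a + b)" using ab by (auto simp: t_def field_simps)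
  have le: "(\<integral>z. \<bar>h z\<bar> powr s \<partial>M) \<le> c powr s"
    if "(\<integral>z. \<bar>h z\<bar> powr s \<partial>M) powr (1 / s) \<le> c" for h :: "'a \<Rightarrow> real" and c
    using powr_mono2[OF _ _ that, of s] s by (simp add: powr_powr integral_nonneg_AE)
  have If: "(\<integral>z. \<bar>f z\<bar> powr s \<partial>M) \<le> a powr s" and Ig: "(\<integral>z. \<bar>g z\<bar> powr s \<partial>M) \<le> b powr s"
    using e by (intro le; simp add: a_def b_def)+
  have pt: "\<bar>f z + g z\<bar> powr s \<le> (a + b) powr s * ((1 - t) * (\<bar>f z\<bar> powr s / a powr s) + t * (\<bar>g z\<bar> powr s / b powr s))" for z
  proof -
    have "f z + g z = (a + b) * ((1 - t) * (f z / a) + t * (g z / b))"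
      (is "_ = ?c * (?x + ?y)")
    proof -
      have "?c * ?x = f z" "?c * ?y = g z"
        unfolding t1 using ab by (simp_all add: t_def)
      then show ?thesis by (simp only: distrib_left)
    qed
    then have "\<bar>f z + g z\<bar> powr s = (a + b) powr s * \<bar>(1 - t) * (f z / a) + t * (g z / b)\<bar> powr s"
      using ab by (simp add: abs_mult powr_mult)
    also have "\<dots> \<le> (a + b) powr s * ((1 - t) * \<bar>f z / a\<bar> powr s + t * \<bar>g z / b\<bar> powr s)"
      by (intro mult_left_mono abs_powr_convex s t) simp
    finally show ?thesis using ab by (simp add: powr_divide)
  qed
  have "(\<integral>z. \<bar>f z + g z\<bar> powr s \<partial>M)
      \<le> (\<integral>z. (a + b) powr s * ((1 - t) * (\<bar>f z\<bar> powr s / a powr s) + t * (\<bar>g z\<bar> powr s / b powr s)) \<partial>M)"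
    using integrable_abs_powr_lincomb[OF s _ _ f g, of 1 1] f g
    by (intro integral_mono pt) auto
  also have "\<dots> = (a + b) powr s * ((1 - t) * ((\<integral>z. \<bar>f z\<bar> powr s \<partial>M) / a powr s) + t * ((\<integral>z. \<bar>g z\<bar> powr s \<partial>M) / b powr s))"
    using f g by simp
  also have "\<dots> \<le> (a + b) powr s * ((1 - t) * 1 + t * 1)"
    using t ab If Ig by (intro mult_left_mono add_mono) (auto simp: divide_le_eq_1)
  finally have "?N \<le> ((a + b) powr s) powr (1 / s)"
    using s by (intro powr_mono2) (auto simp: integral_nonneg_AE)
  also have "\<dots> = a + b" using ab s by (simp add: powr_powr)
  finally show "?N \<le> ?a + ?b + e" by (simp add: a_def b_def)
qed

text \<open>The equality case, for pairs of functions with the norm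
  \<open>(\<integral>\<bar>f1\<bar>\<^sup>s + \<theta> * \<integral>\<bar>f2\<bar>\<^sup>s)\<close> to the power \<open>1 / s\<close>, so that it covers \<open>rho s\<close> (with \<open>\<theta> = 0\<close>) as well as
  \<open>dmetric s \<theta>\<close> (the pair of mid and spread). If equality holds, the gap in the pointwise convexity
  inequality is a non-negative function with integral 0, hence vanishes almost everywhere, and
  strict convexity applies pointwise.\<close>
lemma Minkowski_equality:
  fixes f1 f2 g1 g2 :: "'a \<Rightarrow> real"
  assumes s: "1 < s" and \<theta>: "0 \<le> \<theta>"
    and [measurable]: "f1 \<in> borel_measurable M" "g1 \<in> borel_measurable M"
      "f2 \<in> borel_measurable M" "g2 \<in> borel_measurable M"
    and int: "integrable M (\<lambda>z. \<bar>f1 z\<bar> powr s)" "integrable M (\<lambda>z. \<bar>g1 z\<bar> powr s)"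
      "integrable M (\<lambda>z. \<bar>f2 z\<bar> powr s)" "integrable M (\<lambda>z. \<bar>g2 z\<bar> powr s)"
    and ab: "0 < a" "0 < b"
    and f: "(\<integral>z. \<bar>f1 z\<bar> powr s \<partial>M) + \<theta> * (\<integral>z. \<bar>f2 z\<bar> powr s \<partial>M) = a powr s"
    and g: "(\<integral>z. \<bar>g1 z\<bar> powr s \<partial>M) + \<theta> * (\<integral>z. \<bar>g2 z\<bar> powr s \<partial>M) = b powr s"
    and fg: "(\<integral>z. \<bar>f1 z + g1 z\<bar> powr s \<partial>M) + \<theta> * (\<integral>z. \<bar>f2 z + g2 z\<bar> powr s \<partial>M) = (a + b) powr s"
  shows "AE z in M. f1 z / a = g1 z / b" "0 < \<theta> \<Longrightarrow> AE z in M. f2 z / a = g2 z / b"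
proof -
  define t where "t = b / (a + b)"
  have t: "0 < t" "t < 1" and t1: "1 - t = a / (a + b)" using ab by (auto simp: t_def field_simps)
  define gap where "gap = (\<lambda>(f :: 'a \<Rightarrow> real) (g :: 'a \<Rightarrow> real) z. (1 - t) * \<bar>f z / a\<bar> powr s + t * \<bar>g z / b\<bar> powr s
     - \<bar>(1 - t) * (f z / a) + t * (g z / b)\<bar> powr s :: real)"
  have gap_nonneg: "0 \<le> gap f g z" for f g z
    using abs_powr_convex[of s t "f z / a" "g z / b"] s t by (simp add: gap_def)
  have gap_eq: "gap f g z = (1 - t) / a powr s * \<bar>f z\<bar> powr s + t / b powr s * \<bar>g z\<bar> powr s
      - 1 / (a + b) powr s * \<bar>f z + g z\<bar> powr s" for f g z
  proof -
    have "(1 - t) * (f z / a) + t * (g z / b) = (f z + g z) / (a + b)"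
      unfolding t1 using ab by (simp add: t_def add_divide_distrib)
    then show ?thesis
      using ab by (simp add: gap_def powr_divide)
  qed
  have gap_int: "integrable M (gap f g)"
    and gap_integral: "(\<integral>z. gap f g z \<partial>M) = (1 - t) / a powr s * (\<integral>z. \<bar>f z\<bar> powr s \<partial>M)
      + t / b powr s * (\<integral>z. \<bar>g z\<bar> powr s \<partial>M) - 1 / (a + b) powr s * (\<integral>z. \<bar>f z + g z\<bar> powr s \<partial>M)"
    if fm[measurable]: "f \<in> borel_measurable M" "g \<in> borel_measurable M"
      and i: "integrable M (\<lambda>z. \<bar>f z\<bar> powr s)" "integrable M (\<lambda>z. \<bar>g z\<bar> powr s)" for f g
  proof -
    have *: "integrable M (\<lambda>z. \<bar>f z + g z\<bar> powr s)"
      using integrable_abs_powr_lincomb[OF _ fm i, of 1 1] s by simp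
    have "gap f g = (\<lambda>z. (1 - t) / a powr s * \<bar>f z\<bar> powr s + t / b powr s * \<bar>g z\<bar> powr s
      - 1 / (a + b) powr s * \<bar>f z + g z\<bar> powr s)"
      by (rule ext) (rule gap_eq)
    note eq = this
    show "integrable M (gap f g)" unfolding eq
      using i * by (intro Bochner_Integration.integrable_diff Bochner_Integration.integrable_add integrable_mult_right)
    show "(\<integral>z. gap f g z \<partial>M) = (1 - t) / a powr s * (\<integral>z. \<bar>f z\<bar> powr s \<partial>M)
      + t / b powr s * (\<integral>z. \<bar>g z\<bar> powr s \<partial>M) - 1 / (a + b) powr s * (\<integral>z. \<bar>f z + g z\<bar> powr s \<partial>M)"
      unfolding eq using i * by (simp del: times_divide_eq_left)
  qed
  have sum0: "(\<integral>z. gap f1 g1 z \<partial>M) + \<theta> * (\<integral>z. gap f2 g2 z \<partial>M) = 0"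
  proof -
    have "(\<integral>z. gap f1 g1 z \<partial>M) + \<theta> * (\<integral>z. gap f2 g2 z \<partial>M)
      = (1 - t) / a powr s * ((\<integral>z. \<bar>f1 z\<bar> powr s \<partial>M) + \<theta> * (\<integral>z. \<bar>f2 z\<bar> powr s \<partial>M))
      + t / b powr s * ((\<integral>z. \<bar>g1 z\<bar> powr s \<partial>M) + \<theta> * (\<integral>z. \<bar>g2 z\<bar> powr s \<partial>M))
      - 1 / (a + b) powr s * ((\<integral>z. \<bar>f1 z + g1 z\<bar> powr s \<partial>M) + \<theta> * (\<integral>z. \<bar>f2 z + g2 z\<bar> powr s \<partial>M))"
      by (simp add: gap_integral int algebra_simps del: times_divide_eq_left times_divide_eq_right)
    also have "\<dots> = 0" unfolding f g fg using ab by simp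
    finally show ?thesis .
  qed
  have nn: "0 \<le> (\<integral>z. gap f g z \<partial>M)" for f g
    by (intro integral_nonneg_AE AE_I2 gap_nonneg)
  have AE: "AE z in M. f z / a = g z / b" if "integrable M (gap f g)" "(\<integral>z. gap f g z \<partial>M) = 0" for f g
  proof -
    have "AE z in M. gap f g z = 0"
      using that by (subst (asm) integral_nonneg_eq_0_iff_AE) (auto simp: gap_nonneg)
    then show ?thesis
    proof eventually_elim
      case (elim z)
      then have "\<bar>(1 - t) * (f z / a) + t * (g z / b)\<bar> powr s = (1 - t) * \<bar>f z / a\<bar> powr s + t * \<bar>g z / b\<bar> powr s"
        unfolding gap_def by linarith
      then show ?case by (rule abs_powr_convex_eq[OF s t])
    qed
  qed
  from sum0 nn[of f1 g1] nn[of f2 g2] \<theta> have "(\<integral>z. gap f1 g1 z \<partial>M) = 0"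
    by (smt (verit) mult_nonneg_nonneg)
  then show "AE z in M. f1 z / a = g1 z / b" by (intro AE gap_int int) measurable
  assume "0 < \<theta>"
  with sum0 nn[of f1 g1] nn[of f2 g2] have "(\<integral>z. gap f2 g2 z \<partial>M) = 0"
    by (smt (verit) mult_pos_pos)
  then show "AE z in M. f2 z / a = g2 z / b" by (intro AE gap_int int) measurable
qed

section \<open>Levels and support functions of sums and multiples\<close>

lemma Fc_range: "A \<in> Fc \<Longrightarrow> 0 \<le> A x" "A \<in> Fc \<Longrightarrow> A x \<le> 1"
  by (auto simp: Fc_def)

lemma level_Fc:
  assumes "A \<in> Fc" "0 \<le> \<alpha>" "\<alpha> \<le> 1"
  shows "level A \<alpha> \<noteq> {}" "compact (level A \<alpha>)" "convex (level A \<alpha>)"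
  using assms by (auto simp: Fc_def Kc_def)

lemma level_pos: "0 < \<alpha> \<Longrightarrow> level A \<alpha> = {x. \<alpha> \<le> A x}"
  by (simp add: level_def)

lemma level_antimono:
  assumes "0 \<le> \<alpha>" "\<alpha> \<le> \<beta>"
  shows "level A \<beta> \<subseteq> level A \<alpha>"
proof (cases "\<alpha> = 0 \<and> \<beta> \<noteq> 0")
  case True
  with assms have "level A \<beta> \<subseteq> {x. 0 < A x}" by (auto simp: level_pos)
  also have "\<dots> \<subseteq> level A \<alpha>" using True closure_subset by (simp add: level_def)
  finally show ?thesis .
qed (use assms in \<open>auto simp: level_def\<close>)

text \<open>This form of the finite intersection property passes from the levels \<open>\<beta> < \<alpha>\<close> to the level \<open>\<alpha>\<close>: if \<open>K \<beta>\<close>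
  is a part of \<open>level A \<beta>\<close>, the point obtained lies in \<open>level A \<alpha>\<close>.\<close>
lemma decreasing_compact_family_inter:
  fixes K :: "real \<Rightarrow> 'a::heine_borel set"
  assumes \<alpha>: "0 < \<alpha>"
    and K: "\<And>\<beta>. 0 < \<beta> \<Longrightarrow> \<beta> < \<alpha> \<Longrightarrow> compact (K \<beta>) \<and> K \<beta> \<noteq> {}"
    and anti: "\<And>\<beta> \<gamma>. 0 < \<beta> \<Longrightarrow> \<beta> \<le> \<gamma> \<Longrightarrow> \<gamma> < \<alpha> \<Longrightarrow> K \<gamma> \<subseteq> K \<beta>"
  obtains x where "\<And>\<beta>. 0 < \<beta> \<Longrightarrow> \<beta> < \<alpha> \<Longrightarrow> x \<in> K \<beta>"
proof -
  have "\<Inter> (K ` {0<..<\<alpha>}) \<noteq> {}"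
  proof (rule compact_chain)
    show "compact S" if "S \<in> K ` {0<..<\<alpha>}" for S using that K by auto
    show "{} \<notin> K ` {0<..<\<alpha>}" using K by fastforce
    show "S \<subseteq> T \<or> T \<subseteq> S" if ST: "S \<in> K ` {0<..<\<alpha>} \<and> T \<in> K ` {0<..<\<alpha>}" for S T
    proof -
      obtain \<beta> where b: "S = K \<beta>" "0 < \<beta>" "\<beta> < \<alpha>" using ST by auto
      obtain \<gamma> where c: "T = K \<gamma>" "0 < \<gamma>" "\<gamma> < \<alpha>" using ST by auto
      from b c show ?thesis using anti[of \<beta> \<gamma>] anti[of \<gamma> \<beta>] by (cases "\<beta> \<le> \<gamma>") auto
    qed
  qed
  then obtain x where "x \<in> \<Inter> (K ` {0<..<\<alpha>})" by blast
  then show ?thesis by (intro that) auto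
qed

text \<open>With a strict inequality the supremum in the definition of the sum needs not be attained.\<close>
lemma fuzzy_add_gt_iff:
  assumes "A \<in> Fc" "B \<in> Fc"
  shows "c < (A \<oplus>\<^sub>F B) t \<longleftrightarrow> (\<exists>x y. x + y = t \<and> c < A x \<and> c < B y)"
proof -
  have "bdd_above {min (A x) (B y) |x y. x + y = t}"
    using Fc_range(2)[OF assms(1)] by (intro bdd_aboveI[of _ 1]) (auto simp: min_le_iff_disj)
  moreover have "min (A t) (B 0) \<in> {min (A x) (B y) |x y. x + y = t}" by force
  ultimately have "c < (A \<oplus>\<^sub>F B) t \<longleftrightarrow> (\<exists>z\<in>{min (A x) (B y) |x y. x + y = t}. c < z)"
    unfolding fuzzy_add_def by (intro less_cSup_iff) blast+
  then show ?thesis unfolding Bex_def mem_Collect_eq by (metis min_less_iff_conj)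
qed

lemma fuzzy_add_upper:
  assumes "A \<in> Fc" "B \<in> Fc"
  shows "min (A x) (B y) \<le> (A \<oplus>\<^sub>F B) (x + y)"
proof (rule ccontr)
  assume "\<not> ?thesis"
  then have "(A \<oplus>\<^sub>F B) (x + y) < A x" "(A \<oplus>\<^sub>F B) (x + y) < B y" by auto
  then have "(A \<oplus>\<^sub>F B) (x + y) < (A \<oplus>\<^sub>F B) (x + y)"
    unfolding fuzzy_add_gt_iff[OF assms] by blast
  then show False by simp
qed

text \<open>For \<open>\<alpha> > 0\<close> the inclusion from left to right says that the supremum defining the sum is attained,
  which follows from compactness of the levels below \<open>\<alpha>\<close>. For \<open>\<alpha> = 0\<close> the level is a closure, and the
  sum of two closures is closed because they are compact.\<close>
lemma level_fuzzy_add: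
  assumes A: "A \<in> Fc" and B: "B \<in> Fc" and \<alpha>: "0 \<le> \<alpha>" "\<alpha> \<le> 1"
  shows "level (A \<oplus>\<^sub>F B) \<alpha> = {x + y | x y. x \<in> level A \<alpha> \<and> y \<in> level B \<alpha>}"
proof (cases "\<alpha> = 0")
  case True
  let ?P = "{x. 0 < A x}" and ?Q = "{x. 0 < B x}"
  have PQ: "{t. 0 < (A \<oplus>\<^sub>F B) t} = ?P + ?Q"
    by (auto simp: fuzzy_add_gt_iff[OF A B] set_plus_def)
  have cl: "closure ?P = level A 0" "closure ?Q = level B 0" by (simp_all add: level_def)
  have "compact (closure ?P + closure ?Q)"
  proof -
    have "level A 0 + level B 0 = {x + y | x y. x \<in> level A 0 \<and> y \<in> level B 0}"
      unfolding set_plus_def by blast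
    then show ?thesis
      unfolding cl using compact_sums[OF level_Fc(2)[OF A] level_Fc(2)[OF B], of 0 0] by simp
  qed
  then have "closure (?P + ?Q) \<subseteq> closure ?P + closure ?Q"
    by (intro closure_minimal set_plus_mono2 closure_subset compact_imp_closed)
  with closure_sum[of ?P ?Q] have "level (A \<oplus>\<^sub>F B) 0 = level A 0 + level B 0"
    by (simp add: cl[symmetric] PQ[symmetric]) (simp add: level_def PQ)
  then show ?thesis by (auto simp: True set_plus_def)
next
  case False
  with \<alpha> have pos: "0 < \<alpha>" by simp
  show ?thesis
  proof (intro equalityI subsetI)
    fix t assume "t \<in> level (A \<oplus>\<^sub>F B) \<alpha>"
    then have t: "\<alpha> \<le> (A \<oplus>\<^sub>F B) t" using pos by (simp add: level_pos)
    define K where "K = (\<lambda>\<beta>. level A \<beta> \<inter> (\<lambda>x. t - x) ` level B \<beta>)"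
    have "compact (K \<beta>) \<and> K \<beta> \<noteq> {}" if b: "0 < \<beta>" "\<beta> < \<alpha>" for \<beta>
    proof
      show "compact (K \<beta>)"
        unfolding K_def using that \<alpha> A B
        by (intro compact_Int compact_continuous_image continuous_intros level_Fc) auto
      obtain x y where "x + y = t" "\<beta> < A x" "\<beta> < B y"
        using less_le_trans[OF b(2) t] unfolding fuzzy_add_gt_iff[OF A B] by blast
      then have "x \<in> K \<beta>" using that by (auto simp: K_def level_pos intro!: image_eqI[of _ _ y])
      then show "K \<beta> \<noteq> {}" by auto
    qed
    moreover have "K \<gamma> \<subseteq> K \<beta>" if "0 < \<beta>" "\<beta> \<le> \<gamma>" "\<gamma> < \<alpha>" for \<beta> \<gamma>
      unfolding K_def using that level_antimono[of \<beta> \<gamma>]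
      by (intro Int_mono image_mono) auto
    ultimately obtain x where x: "\<And>\<beta>. 0 < \<beta> \<Longrightarrow> \<beta> < \<alpha> \<Longrightarrow> x \<in> K \<beta>"
      using decreasing_compact_family_inter[OF pos, of K] by blast
    have "\<beta> \<le> A x \<and> \<beta> \<le> B (t - x)" if "0 < \<beta>" "\<beta> < \<alpha>" for \<beta>
      using x[OF that] that by (auto simp: K_def level_pos)
    then have "\<alpha> \<le> A x" "\<alpha> \<le> B (t - x)"
      by (intro dense_le_bounded[OF pos]; simp)+
    then show "t \<in> {x + y | x y. x \<in> level A \<alpha> \<and> y \<in> level B \<alpha>}"
      using pos by (intro CollectI exI[of _ x] exI[of _ "t - x"]) (simp add: level_pos)
  next
    fix t assume "t \<in> {x + y | x y. x \<in> level A \<alpha> \<and> y \<in> level B \<alpha>}"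
    then obtain x y where "t = x + y" "\<alpha> \<le> A x" "\<alpha> \<le> B y" using pos by (auto simp: level_pos)
    then show "t \<in> level (A \<oplus>\<^sub>F B) \<alpha>"
      using fuzzy_add_upper[OF A B, of x y] pos by (auto simp: level_pos)
  qed
qed

lemma fuzzy_scale_nonzero:
  assumes "A \<in> Fc" "\<gamma> \<noteq> 0"
  shows "(\<gamma> \<odot>\<^sub>F A) t = A (t /\<^sub>R \<gamma>)"
proof -
  have "{A x |x. \<gamma> *\<^sub>R x = t} = {A (t /\<^sub>R \<gamma>)}" using assms by auto
  then show ?thesis
    using Fc_range(1)[OF assms(1)] by (simp add: fuzzy_scale_def cSup_eq_Max)
qed

lemma fuzzy_scale_zero:
  assumes "A \<in> Fc"
  shows "0 \<odot>\<^sub>F A = indicator {0}"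
proof
  fix t
  obtain x where "x \<in> level A 1" using level_Fc(1)[OF assms, of 1] by auto
  then have x: "A x = 1" using Fc_range(2)[OF assms, of x] by (simp add: level_pos)
  show "(0 \<odot>\<^sub>F A) t = indicator {0} t"
    using x Fc_range(2)[OF assms] unfolding fuzzy_scale_def
    by (cases "t = 0") (auto intro!: cSup_eq_maximum)
qed

lemma level_fuzzy_scale:
  assumes A: "A \<in> Fc" and \<alpha>: "0 \<le> \<alpha>" "\<alpha> \<le> 1"
  shows "level (\<gamma> \<odot>\<^sub>F A) \<alpha> = (*\<^sub>R) \<gamma> ` level A \<alpha>"
proof (cases "\<gamma> = 0")
  case True
  have "level (indicator {0} :: 'a fuzzy) \<alpha> = {0}"
  proof -
    have "{x. 0 < (indicator {0} x :: real)} = {0 :: real ^ 'a}"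
      by (auto simp: indicator_def split: if_splits)
    moreover have "{x. \<alpha> \<le> (indicator {0} x :: real)} = {0 :: real ^ 'a}" if "0 < \<alpha>"
      using that \<alpha> by (auto simp: indicator_def split: if_splits)
    ultimately show ?thesis using \<alpha> by (cases "\<alpha> = 0") (auto simp: level_def)
  qed
  moreover have "(*\<^sub>R) \<gamma> ` level A \<alpha> = {0}" using True level_Fc(1)[OF A \<alpha>] by auto
  ultimately show ?thesis using True fuzzy_scale_zero[OF A] by simp
next
  case False
  have img: "{x. Q (x /\<^sub>R \<gamma>)} = (*\<^sub>R) \<gamma> ` {x. Q x}" for Q :: "real ^ 'a \<Rightarrow> bool"
    using False by (force simp: image_iff)
  show ?thesis
    using img[of "\<lambda>x. 0 < A x"] img[of "\<lambda>x. \<alpha> \<le> A x"]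
    by (simp add: level_def fuzzy_scale_nonzero[OF A False] closure_scaleR)
qed

lemma fuzzy_scale_Fc:
  assumes "A \<in> Fc"
  shows "\<gamma> \<odot>\<^sub>F A \<in> Fc"
  unfolding Fc_def
proof (intro CollectI conjI ballI allI)
  show "(\<gamma> \<odot>\<^sub>F A) x \<in> {0..1}" for x
    using Fc_range[OF assms]
    by (cases "\<gamma> = 0") (auto simp: fuzzy_scale_nonzero[OF assms] fuzzy_scale_zero[OF assms] indicator_def)
  show "level (\<gamma> \<odot>\<^sub>F A) \<alpha> \<in> Kc" if "\<alpha> \<in> {0..1}" for \<alpha>
    using that level_Fc[OF assms, of \<alpha>]
    by (auto simp: level_fuzzy_scale[OF assms] Kc_def intro: compact_scaling convex_scaling)
qed

lemma fuzzy_add_Fc: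
  assumes A: "A \<in> Fc" and B: "B \<in> Fc"
  shows "A \<oplus>\<^sub>F B \<in> Fc"
  unfolding Fc_def
proof (intro CollectI conjI ballI allI)
  fix x
  have "\<not> 1 < (A \<oplus>\<^sub>F B) x"
    using Fc_range(2)[OF A] by (auto simp: fuzzy_add_gt_iff[OF A B] not_less)
  moreover have "0 \<le> (A \<oplus>\<^sub>F B) x"
    using fuzzy_add_upper[OF A B, of x 0] Fc_range(1)[OF A, of x] Fc_range(1)[OF B, of 0] by simp
  ultimately show "(A \<oplus>\<^sub>F B) x \<in> {0..1}" by auto
next
  fix \<alpha> :: real assume "\<alpha> \<in> {0..1}"
  then have \<alpha>: "0 \<le> \<alpha>" "\<alpha> \<le> 1" by auto
  have "{x + y | x y. x \<in> level A \<alpha> \<and> y \<in> level B \<alpha>} = (\<Union>x\<in>level A \<alpha>. \<Union>y\<in>level B \<alpha>. {x + y})"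
    by blast
  then show "level (A \<oplus>\<^sub>F B) \<alpha> \<in> Kc"
    using level_Fc[OF A \<alpha>] level_Fc[OF B \<alpha>]
    by (auto simp: level_fuzzy_add[OF A B \<alpha>] Kc_def intro: compact_sums' convex_sums)
qed

lemma supp_fun_eqI:
  assumes "v \<in> level A \<alpha>" "\<And>w. w \<in> level A \<alpha> \<Longrightarrow> u \<bullet> w \<le> u \<bullet> v"
  shows "supp_fun A (u, \<alpha>) = u \<bullet> v"
  unfolding supp_fun_def using assms by (auto intro!: cSup_eq_maximum)

lemma supp_fun_attained:
  assumes "A \<in> Fc" "0 \<le> \<alpha>" "\<alpha> \<le> 1"
  obtains v where "v \<in> level A \<alpha>" "supp_fun A (u, \<alpha>) = u \<bullet> v" "\<And>w. w \<in> level A \<alpha> \<Longrightarrow> u \<bullet> w \<le> u \<bullet> v"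
proof -
  have "continuous_on (level A \<alpha>) (\<lambda>w. u \<bullet> w)" by (intro continuous_intros)
  then obtain v where v: "v \<in> level A \<alpha>" "\<And>w. w \<in> level A \<alpha> \<Longrightarrow> u \<bullet> w \<le> u \<bullet> v"
    using continuous_attains_sup[of "level A \<alpha>" "\<lambda>w. u \<bullet> w"] level_Fc[OF assms] by auto
  show ?thesis by (rule that[OF v(1) supp_fun_eqI[OF v] v(2)])
qed

lemma supp_fun_upper:
  assumes "A \<in> Fc" "0 \<le> \<alpha>" "\<alpha> \<le> 1" "v \<in> level A \<alpha>"
  shows "u \<bullet> v \<le> supp_fun A (u, \<alpha>)"
  using assms by (metis supp_fun_attained)

lemma supp_fun_add:
  assumes A: "A \<in> Fc" and B: "B \<in> Fc" and \<alpha>: "0 \<le> \<alpha>" "\<alpha> \<le> 1"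
  shows "supp_fun (A \<oplus>\<^sub>F B) (u, \<alpha>) = supp_fun A (u, \<alpha>) + supp_fun B (u, \<alpha>)"
proof -
  obtain v where v: "v \<in> level A \<alpha>" "supp_fun A (u, \<alpha>) = u \<bullet> v" "\<And>x. x \<in> level A \<alpha> \<Longrightarrow> u \<bullet> x \<le> u \<bullet> v"
    using supp_fun_attained[OF A \<alpha>] by blast
  obtain w where w: "w \<in> level B \<alpha>" "supp_fun B (u, \<alpha>) = u \<bullet> w" "\<And>x. x \<in> level B \<alpha> \<Longrightarrow> u \<bullet> x \<le> u \<bullet> w"
    using supp_fun_attained[OF B \<alpha>] by blast
  have "supp_fun (A \<oplus>\<^sub>F B) (u, \<alpha>) = u \<bullet> (v + w)"
  proof (rule supp_fun_eqI)
    show "v + w \<in> level (A \<oplus>\<^sub>F B) \<alpha>" using v(1) w(1) by (auto simp: level_fuzzy_add[OF A B \<alpha>])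
    fix z assume "z \<in> level (A \<oplus>\<^sub>F B) \<alpha>"
    then obtain x y where "z = x + y" "x \<in> level A \<alpha>" "y \<in> level B \<alpha>"
      by (auto simp: level_fuzzy_add[OF A B \<alpha>])
    then show "u \<bullet> z \<le> u \<bullet> (v + w)" using add_mono[OF v(3) w(3)] by (simp add: inner_add_right)
  qed
  then show ?thesis by (simp add: v w inner_add_right)
qed

lemma supp_fun_scale:
  assumes A: "A \<in> Fc" and \<alpha>: "0 \<le> \<alpha>" "\<alpha> \<le> 1" and \<gamma>: "0 \<le> \<gamma>"
  shows "supp_fun (\<gamma> \<odot>\<^sub>F A) (u, \<alpha>) = \<gamma> * supp_fun A (u, \<alpha>)"
proof -
  obtain v where v: "v \<in> level A \<alpha>" "supp_fun A (u, \<alpha>) = u \<bullet> v" "\<And>x. x \<in> level A \<alpha> \<Longrightarrow> u \<bullet> x \<le> u \<bullet> v"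
    using supp_fun_attained[OF A \<alpha>] by blast
  have "supp_fun (\<gamma> \<odot>\<^sub>F A) (u, \<alpha>) = u \<bullet> (\<gamma> *\<^sub>R v)"
  proof (rule supp_fun_eqI)
    show "\<gamma> *\<^sub>R v \<in> level (\<gamma> \<odot>\<^sub>F A) \<alpha>" using v(1) by (auto simp: level_fuzzy_scale[OF A \<alpha>])
    fix z assume "z \<in> level (\<gamma> \<odot>\<^sub>F A) \<alpha>"
    then obtain x where "z = \<gamma> *\<^sub>R x" "x \<in> level A \<alpha>" by (auto simp: level_fuzzy_scale[OF A \<alpha>])
    then show "u \<bullet> z \<le> u \<bullet> (\<gamma> *\<^sub>R v)" using mult_left_mono[OF v(3) \<gamma>] by simp
  qed
  then show ?thesis by (simp add: v)
qed

lemma norm_le_set_mag: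
  assumes "A \<in> Fc" "0 \<le> \<alpha>" "\<alpha> \<le> 1" "v \<in> level A \<alpha>"
  shows "norm v \<le> set_mag (level A 0)"
proof -
  have "v \<in> level A 0" using level_antimono[of 0 \<alpha> A] assms by auto
  moreover have "bdd_above (norm ` level A 0)"
    using level_Fc(2)[OF assms(1), of 0]
    by (intro bounded_imp_bdd_above compact_imp_bounded compact_continuous_image continuous_intros) auto
  ultimately show ?thesis unfolding set_mag_def by (intro cSUP_upper)
qed

lemma set_mag_nonneg:
  assumes "A \<in> Fc"
  shows "0 \<le> set_mag (level A 0)"
proof -
  obtain v where "v \<in> level A 0" using level_Fc(1)[OF assms, of 0] by auto
  with norm_le_set_mag[OF assms, of 0 v] norm_ge_zero[of v] show ?thesis by linarith
qed

lemma supp_fun_Lipschitz: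
  assumes A: "A \<in> Fc" and \<alpha>: "0 \<le> \<alpha>" "\<alpha> \<le> 1"
  shows "\<bar>supp_fun A (u, \<alpha>) - supp_fun A (u', \<alpha>)\<bar> \<le> norm (u - u') * set_mag (level A 0)"
proof -
  have le: "supp_fun A (u, \<alpha>) - supp_fun A (u', \<alpha>) \<le> norm (u - u') * set_mag (level A 0)" for u u'
  proof -
    obtain v where v: "v \<in> level A \<alpha>" "supp_fun A (u, \<alpha>) = u \<bullet> v"
      using supp_fun_attained[OF A \<alpha>] by blast
    have "supp_fun A (u, \<alpha>) - supp_fun A (u', \<alpha>) \<le> (u - u') \<bullet> v"
      using supp_fun_upper[OF A \<alpha> v(1), of u'] v by (simp add: inner_diff_left)
    also have "\<dots> \<le> norm (u - u') * norm v" by (rule norm_cauchy_schwarz)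
    also have "\<dots> \<le> norm (u - u') * set_mag (level A 0)"
      using norm_le_set_mag[OF A \<alpha> v(1)] by (intro mult_left_mono) auto
    finally show ?thesis .
  qed
  show ?thesis using le[of u u'] le[of u' u] by (simp add: norm_minus_commute abs_le_iff)
qed

lemma supp_fun_zero: 
  assumes "A \<in> Fc" "0 \<le> \<alpha>" "\<alpha> \<le> 1"
  shows "supp_fun A (0, \<alpha>) = 0"
  using supp_fun_attained[OF assms, of 0] by (metis inner_zero_left)

lemma abs_supp_fun_le:
  assumes "A \<in> Fc" "0 \<le> \<alpha>" "\<alpha> \<le> 1"
  shows "\<bar>supp_fun A (u, \<alpha>)\<bar> \<le> norm u * set_mag (level A 0)"
  using supp_fun_Lipschitz[OF assms, of u 0] supp_fun_zero[OF assms] by simp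

lemma supp_fun_antimono:
  assumes "A \<in> Fc" "0 \<le> \<alpha>" "\<alpha> \<le> \<beta>" "\<beta> \<le> 1"
  shows "supp_fun A (u, \<beta>) \<le> supp_fun A (u, \<alpha>)"
proof -
  obtain v where v: "v \<in> level A \<beta>" "supp_fun A (u, \<beta>) = u \<bullet> v"
    using supp_fun_attained[of A \<beta> u] assms by auto
  with level_antimono[of \<alpha> \<beta> A] assms show ?thesis
    using supp_fun_upper[of A \<alpha> v u] by auto
qed

text \<open>The level \<open>\<alpha> > 0\<close> is the intersection of the levels below it. If each of these contains a point \<open>v\<close> with
  \<open>c \<le> u \<bullet> v\<close>, so does their intersection. This is the only non-trivial half of left continuity, since
  the support function decreases in the level.\<close>
lemma supp_fun_left_limit:
  assumes A: "A \<in> Fc" and \<alpha>: "0 < \<alpha>" "\<alpha> \<le> 1"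
    and c: "\<And>\<beta>. 0 < \<beta> \<Longrightarrow> \<beta> < \<alpha> \<Longrightarrow> c \<le> supp_fun A (u, \<beta>)"
  shows "c \<le> supp_fun A (u, \<alpha>)"
proof -
  define K where "K = (\<lambda>\<beta>. level A \<beta> \<inter> {v. c \<le> u \<bullet> v})"
  have "compact (K \<beta>) \<and> K \<beta> \<noteq> {}" if b: "0 < \<beta>" "\<beta> < \<alpha>" for \<beta>
  proof
    have "closed {v. c \<le> u \<bullet> v}" by (intro closed_Collect_le continuous_intros)
    then show "compact (K \<beta>)" unfolding K_def using b \<alpha> A
      by (intro compact_Int_closed level_Fc) auto
    obtain v where "v \<in> level A \<beta>" "supp_fun A (u, \<beta>) = u \<bullet> v"
      using supp_fun_attained[of A \<beta> u] A b \<alpha> by auto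
    with c[OF b] show "K \<beta> \<noteq> {}" by (auto simp: K_def)
  qed
  moreover have "K \<gamma> \<subseteq> K \<beta>" if "0 < \<beta>" "\<beta> \<le> \<gamma>" "\<gamma> < \<alpha>" for \<beta> \<gamma>
    unfolding K_def using that level_antimono[of \<beta> \<gamma> A] by auto
  ultimately obtain x where x: "\<And>\<beta>. 0 < \<beta> \<Longrightarrow> \<beta> < \<alpha> \<Longrightarrow> x \<in> K \<beta>"
    using decreasing_compact_family_inter[OF \<alpha>(1), of K] by blast
  have "\<alpha> \<le> A x" using x by (intro dense_le_bounded[OF \<alpha>(1)]) (auto simp: K_def level_pos)
  then have "u \<bullet> x \<le> supp_fun A (u, \<alpha>)"
    using A \<alpha> by (intro supp_fun_upper) (auto simp: level_pos)
  moreover have "c \<le> u \<bullet> x" using x[of "\<alpha> / 2"] \<alpha> by (auto simp: K_def)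
  ultimately show ?thesis by simp
qed

lemma supp_fun_left_continuous:
  assumes A: "A \<in> Fc" and \<alpha>: "0 < \<alpha>" "\<alpha> \<le> 1"
    and lim: "b \<longlonglongrightarrow> \<alpha>" and b: "\<And>i. 0 \<le> b i" "\<And>i. b i \<le> \<alpha>"
  shows "(\<lambda>i. supp_fun A (u, b i)) \<longlonglongrightarrow> supp_fun A (u, \<alpha>)"
proof (rule tendstoI)
  fix e :: real assume e: "0 < e"
  have "\<not> (\<forall>\<beta>. 0 < \<beta> \<longrightarrow> \<beta> < \<alpha> \<longrightarrow> supp_fun A (u, \<alpha>) + e \<le> supp_fun A (u, \<beta>))"
    using supp_fun_left_limit[OF A \<alpha>, of "supp_fun A (u, \<alpha>) + e" u] e by auto
  then obtain \<beta> where \<beta>: "0 < \<beta>" "\<beta> < \<alpha>" "supp_fun A (u, \<beta>) < supp_fun A (u, \<alpha>) + e" by force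
  have "eventually (\<lambda>i. \<beta> < b i) sequentially" using order_tendstoD(1)[OF lim \<beta>(2)] .
  then show "eventually (\<lambda>i. dist (supp_fun A (u, b i)) (supp_fun A (u, \<alpha>)) < e) sequentially"
  proof eventually_elim
    case (elim i)
    have "supp_fun A (u, b i) \<le> supp_fun A (u, \<beta>)"
      using elim \<beta> b(2)[of i] \<alpha> A by (intro supp_fun_antimono) auto
    moreover have "supp_fun A (u, \<alpha>) \<le> supp_fun A (u, b i)"
      using b[of i] \<alpha> A by (intro supp_fun_antimono) auto
    ultimately show ?case using \<beta> by (simp add: dist_real_def)
  qed
qed

section \<open>Measurability of support functions\<close>

lemma support_le_hausdorff:
  assumes K: "K \<in> Kc" and L: "L \<in> Kc"
  shows "(SUP v\<in>K. u \<bullet> v) \<le> (SUP v\<in>L. u \<bullet> v) + norm u * hausdorff K L"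
proof (rule cSUP_least)
  show "K \<noteq> {}" using K by (simp add: Kc_def)
  fix x assume x: "x \<in> K"
  have "bdd_above ((\<lambda>x. infdist x L) ` K)"
    using K by (intro bounded_imp_bdd_above compact_imp_bounded compact_continuous_image
        continuous_on_infdist) (auto simp: Kc_def)
  then have "infdist x L \<le> (SUP x\<in>K. infdist x L)" using x by (intro cSUP_upper)
  also have "\<dots> \<le> hausdorff K L" using K L by (simp add: hausdorff_def)
  finally have h: "infdist x L \<le> hausdorff K L" .
  obtain y where y: "y \<in> L" "infdist x L = dist x y"
    using infdist_attains_inf[of L x] L by (auto simp: Kc_def compact_imp_closed)
  have "u \<bullet> x = u \<bullet> y + u \<bullet> (x - y)" by (simp add: inner_diff_right)
  also have "u \<bullet> (x - y) \<le> norm u * norm (x - y)" by (rule norm_cauchy_schwarz)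
  also have "\<dots> \<le> norm u * hausdorff K L"
    using h y by (intro mult_left_mono) (auto simp: dist_norm)
  also have "u \<bullet> y \<le> (SUP v\<in>L. u \<bullet> v)"
    using L y by (intro cSUP_upper bounded_imp_bdd_above compact_imp_bounded compact_continuous_image continuous_intros)
      (auto simp: Kc_def)
  finally show "u \<bullet> x \<le> (SUP v\<in>L. u \<bullet> v) + norm u * hausdorff K L" by simp
qed

lemma space_hausdorff_borel: "space hausdorff_borel = Kc"
  by (simp add: hausdorff_borel_def space_measure_of_conv)

lemma measurable_support_hausdorff_borel:
  "(\<lambda>K. SUP v\<in>K. u \<bullet> v) \<in> borel_measurable hausdorff_borel"
  unfolding borel_measurable_iff_greater space_hausdorff_borel
proof
  fix c
  interpret Metric_space Kc hausdorff by (rule Metric_space_hausdorff)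
  let ?s = "\<lambda>K. SUP v\<in>K. u \<bullet> v"
  have "openin mtopology {K \<in> Kc. c < ?s K}"
    unfolding openin_mtopology
  proof (intro conjI allI impI)
    fix K assume "K \<in> {K \<in> Kc. c < ?s K}"
    then have K: "K \<in> Kc" "c < ?s K" by auto
    define e where "e = (?s K - c) / (norm u + 1)"
    have pos: "0 < norm u + 1" by (simp add: add_nonneg_pos)
    with K have e: "0 < e" by (simp add: e_def)
    have "mball K e \<subseteq> {K \<in> Kc. c < ?s K}"
    proof
      fix L assume "L \<in> mball K e"
      then have L: "L \<in> Kc" "hausdorff K L < e" by auto
      have "norm u * hausdorff K L \<le> (norm u + 1) * hausdorff K L"
        by (intro mult_right_mono) auto
      also have "\<dots> < (norm u + 1) * e" using L pos by (intro mult_strict_left_mono)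
      also have "\<dots> = ?s K - c" using pos by (simp add: e_def)
      finally show "L \<in> {K \<in> Kc. c < ?s K}"
        using support_le_hausdorff[OF K(1) L(1), of u] L by auto
    qed
    with e show "\<exists>r>0. mball K r \<subseteq> {K \<in> Kc. c < ?s K}" by blast
  qed auto
  moreover have "{U. openin mtopology U} \<subseteq> Pow Kc"
    using openin_subset by fastforce
  ultimately show "{K \<in> Kc. c < ?s K} \<in> sets hausdorff_borel"
    unfolding hausdorff_borel_def by (intro in_measure_of) auto
qed

lemma fuzzy_rv_Fc: "fuzzy_rv P X \<Longrightarrow> \<omega> \<in> space P \<Longrightarrow> X \<omega> \<in> Fc"
  by (auto simp: fuzzy_rv_def)

lemma measurable_supp_fun_at:
  assumes "fuzzy_rv P X" "0 \<le> \<alpha>" "\<alpha> \<le> 1"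
  shows "(\<lambda>\<omega>. supp_fun (X \<omega>) (u, \<alpha>)) \<in> borel_measurable P"
proof -
  have "(\<lambda>\<omega>. level (X \<omega>) \<alpha>) \<in> P \<rightarrow>\<^sub>M hausdorff_borel"
    using assms by (auto simp: fuzzy_rv_def)
  from measurable_compose[OF this measurable_support_hausdorff_borel]
  show ?thesis by (simp add: supp_fun_def)
qed

abbreviation sphere_levels :: "((real ^ 'n::finite) \<times> real) measure" where
  "sphere_levels \<equiv> sphere_measure \<Otimes>\<^sub>M restrict_space lborel {0..1}"

lemma space_sphere_levels: "space sphere_levels = sphere 0 1 \<times> {0..1}"
  by (simp add: space_pair_measure space_sphere_measure space_restrict_space)

lemma prob_space_sphere_levels: "prob_space sphere_levels"
proof -
  interpret S: prob_space sphere_measure by (rule prob_space_sphere_measure)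
  interpret L: prob_space "restrict_space lborel {0..1::real}"
    by (intro prob_space_restrict_space) auto
  interpret pair_prob_space sphere_measure "restrict_space lborel {0..1::real}" ..
  show ?thesis by (rule prob_space_axioms)
qed

lemma measurable_sphere_measure_borel: "(\<lambda>u. u) \<in> sphere_measure \<rightarrow>\<^sub>M borel"
  unfolding measurable_cong_sets[OF sets_sphere_measure refl]
  by (rule measurable_restrict_space1) simp

text \<open>At a fixed direction and level the support function of a fuzzy random variable is measurable, since
  it is a Lipschitz function of the level set. It is Lipschitz continuous in the
  direction \<open>u\<close> and left continuous in the level \<open>\<alpha>\<close>. So it is the limit of the functions obtained on replacing
  \<open>u\<close> by the values \<open>q i u\<close> of simple functions that converge to \<open>u\<close>, and \<open>\<alpha>\<close> by the largest multiple of
  \<open>1 / (i + 1)\<close> that is strictly below it; these functions are measurable because only countably many directions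
  and levels occur in each of them.\<close>
lemma measurable_supp_fun:
  fixes X :: "'w \<Rightarrow> 'n::finite fuzzy"
  assumes X: "fuzzy_rv P X"
  shows "(\<lambda>(\<omega>, z). supp_fun (X \<omega>) z) \<in> borel_measurable (P \<Otimes>\<^sub>M sphere_levels)"
proof -
  let ?M = "P \<Otimes>\<^sub>M sphere_levels :: ('w \<times> (real ^ 'n) \<times> real) measure"
  obtain q :: "nat \<Rightarrow> real ^ 'n \<Rightarrow> real ^ 'n"
    where q: "\<And>i. simple_function borel (q i)" "\<And>u. (\<lambda>i. q i u) \<longlonglongrightarrow> u"
    using borel_measurable_implies_sequence_metric[of "\<lambda>u. u" "borel :: (real ^ 'n) measure" 0] by auto
  (* The cut-off at 0 and 1 makes every b i k a level; for k = N i \<alpha> it is effective only at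
     \<alpha> = 0, where it produces the constant sequence 0. *)
  define b :: "nat \<Rightarrow> int \<Rightarrow> real"
    where "b = (\<lambda>i k. min 1 (max 0 ((of_int k - 1) / (real i + 1))))"
  define N :: "nat \<Rightarrow> real \<Rightarrow> int" where "N = (\<lambda>i \<alpha>. \<lceil>(real i + 1) * \<alpha>\<rceil>)"
  have b01: "0 \<le> b i k" "b i k \<le> 1" for i k by (auto simp: b_def)
  have u_meas: "(\<lambda>x. fst (snd x)) \<in> ?M \<rightarrow>\<^sub>M borel"
    by (rule measurable_compose[OF _ measurable_sphere_measure_borel]) measurable
  have "(\<lambda>x. x) \<in> restrict_space lborel {0..1::real} \<rightarrow>\<^sub>M borel"
    by (rule measurable_restrict_space1) simp
  from measurable_compose[OF _ this]
  have [measurable]: "(\<lambda>x. snd (snd x)) \<in> borel_measurable ?M" by measurable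
  show ?thesis
  proof (rule borel_measurable_LIMSEQ_metric)
    fix i
    have "(\<lambda>x. supp_fun (X (fst x)) (v, b i (N i (snd (snd x))))) \<in> borel_measurable ?M" for v
    proof (rule measurable_compose_countable)
      show "(\<lambda>x. supp_fun (X (fst x)) (v, b i k)) \<in> borel_measurable ?M" for k
        by (rule measurable_compose[OF measurable_fst measurable_supp_fun_at[OF X b01]])
      show "(\<lambda>x. N i (snd (snd x))) \<in> ?M \<rightarrow>\<^sub>M count_space UNIV"
        unfolding N_def by measurable
    qed
    note v = this
    show "(\<lambda>x. supp_fun (X (fst x)) (q i (fst (snd x)), b i (N i (snd (snd x))))) \<in> borel_measurable ?M"
    proof (rule measurable_compose_countable'[OF v])
      have fin: "finite (range (q i))" using q(1)[of i] by (simp add: simple_function_def)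
      then show "countable (range (q i))" by (rule countable_finite)
      have "q i \<in> borel \<rightarrow>\<^sub>M count_space (range (q i))"
        using q(1)[of i] fin by (auto simp: measurable_count_space_eq2 simple_function_def)
      from measurable_compose[OF u_meas this]
      show "(\<lambda>x. q i (fst (snd x))) \<in> ?M \<rightarrow>\<^sub>M count_space (range (q i))" .
    qed
  next
    fix x assume "x \<in> space ?M"
    then obtain \<omega> u \<alpha> where x: "x = (\<omega>, u, \<alpha>)" "\<omega> \<in> space P" "0 \<le> \<alpha>" "\<alpha> \<le> 1"
      by (auto simp: space_pair_measure space_restrict_space)
    have F: "X \<omega> \<in> Fc" using X x by (auto intro: fuzzy_rv_Fc)
    let ?c = "set_mag (level (X \<omega>) 0)"
    define \<beta> where "\<beta> = (\<lambda>i. b i (N i \<alpha>))"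
    have \<beta>: "0 \<le> \<beta> i" "\<beta> i \<le> \<alpha>" "\<alpha> - 1 / (real i + 1) \<le> \<beta> i" for i
    proof -
      have "(real_of_int (N i \<alpha>) - 1) < (real i + 1) * \<alpha>" unfolding N_def by linarith
      then have le: "(real_of_int (N i \<alpha>) - 1) / (real i + 1) < \<alpha>" by (simp add: field_simps)
      have "(real i + 1) * \<alpha> - 1 \<le> real_of_int (N i \<alpha>) - 1" unfolding N_def by linarith
      then have "((real i + 1) * \<alpha> - 1) / (real i + 1) \<le> (real_of_int (N i \<alpha>) - 1) / (real i + 1)"
        by (intro divide_right_mono) auto
      then have "\<alpha> - 1 / (real i + 1) \<le> (real_of_int (N i \<alpha>) - 1) / (real i + 1)"
        by (simp add: diff_divide_distrib)
      with le x show "0 \<le> \<beta> i" "\<beta> i \<le> \<alpha>" "\<alpha> - 1 / (real i + 1) \<le> \<beta> i"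
        by (auto simp: \<beta>_def b_def)
    qed
    have lim: "(\<lambda>i. supp_fun (X \<omega>) (u, \<beta> i)) \<longlonglongrightarrow> supp_fun (X \<omega>) (u, \<alpha>)"
    proof (cases "\<alpha> = 0")
      case True
      then have "\<beta> i = \<alpha>" for i using \<beta>[of i] by auto
      then show ?thesis by simp
    next
      case False
      have "(\<lambda>i. \<alpha> - 1 / (real i + 1)) \<longlonglongrightarrow> \<alpha>"
        using tendsto_diff[OF tendsto_const LIMSEQ_inverse_real_of_nat, of \<alpha>]
        by (simp add: inverse_eq_divide add.commute)
      then have "\<beta> \<longlonglongrightarrow> \<alpha>"
        by (rule tendsto_sandwich[OF _ _ _ tendsto_const, rotated 2]) (auto simp: \<beta>)
      then show ?thesis using False x \<beta> by (intro supp_fun_left_continuous[OF F]) auto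
    qed
    have "(\<lambda>i. norm (q i u - u) * ?c) \<longlonglongrightarrow> norm (u - u) * ?c"
      by (intro tendsto_intros q)
    then have g: "(\<lambda>i. norm (q i u - u) * ?c) \<longlonglongrightarrow> 0" by simp
    have "(\<lambda>i. supp_fun (X \<omega>) (q i u, \<beta> i) - supp_fun (X \<omega>) (u, \<beta> i)) \<longlonglongrightarrow> 0"
    proof (rule Lim_null_comparison[OF _ g])
      have "\<beta> i \<le> 1" for i using \<beta>(2)[of i] x by simp
      then show "\<forall>\<^sub>F i in sequentially. norm (supp_fun (X \<omega>) (q i u, \<beta> i) - supp_fun (X \<omega>) (u, \<beta> i)) \<le> norm (q i u - u) * ?c"
        using supp_fun_Lipschitz[OF F \<beta>(1)] by (intro always_eventually allI) simp
    qed
    from tendsto_add[OF this lim]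
    show "(\<lambda>i. supp_fun (X (fst x)) (q i (fst (snd x)), b i (N i (snd (snd x)))))
        \<longlonglongrightarrow> (case x of (\<omega>, z) \<Rightarrow> supp_fun (X \<omega>) z)"
      by (simp add: x \<beta>_def)
  qed
qed

text \<open>A fuzzy set is a fuzzy random variable on a one-point space.\<close>
lemma measurable_supp_fun_const:
  assumes "A \<in> Fc"
  shows "supp_fun A \<in> borel_measurable sphere_levels"
proof -
  let ?P = "count_space UNIV :: unit measure"
  have "fuzzy_rv ?P (\<lambda>_. A)"
    using assms by (auto simp: fuzzy_rv_def space_hausdorff_borel Fc_def)
  from measurable_compose[OF measurable_Pair1' measurable_supp_fun[OF this], of "()"]
  show ?thesis by simp
qed

section \<open>Norms of support functions, mids and spreads\<close>

lemma distr_sphere_levels_reflect: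
  "distr sphere_levels sphere_levels (\<lambda>(u, \<alpha>). (- u, \<alpha>)) = (sphere_levels :: ((real ^ 'n::finite) \<times> real) measure)"
proof -
  let ?L = "restrict_space lborel {0..1::real}"
  let ?S = "sphere_measure :: (real ^ 'n) measure"
  have orth: "orthogonal_transformation (uminus :: real ^ 'n \<Rightarrow> real ^ 'n)"
    by (simp add: orthogonal_transformation linear_uminus)
  interpret L: prob_space ?L by (intro prob_space_restrict_space) auto
  have "uminus \<in> ?S \<rightarrow>\<^sub>M ?S"
    unfolding sphere_measure_def by (intro measurable_restrict_space3) auto
  then have "distr ?S ?S uminus \<Otimes>\<^sub>M distr ?L ?L (\<lambda>x. x)
      = distr (?S \<Otimes>\<^sub>M ?L) (?S \<Otimes>\<^sub>M ?L) (\<lambda>(u, \<alpha>). (- u, \<alpha>))"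
    by (intro pair_measure_distr) (auto intro: L.sigma_finite_measure_axioms)
  then show ?thesis by (simp add: distr_sphere_measure_orthogonal[OF orth])
qed

lemma measurable_reflect:
  "(\<lambda>(u, \<alpha>). (- u, \<alpha>)) \<in> sphere_levels \<rightarrow>\<^sub>M (sphere_levels :: ((real ^ 'n::finite) \<times> real) measure)"
proof -
  have [measurable]: "uminus \<in> sphere_measure \<rightarrow>\<^sub>M (sphere_measure :: (real ^ 'n) measure)"
    unfolding sphere_measure_def by (intro measurable_restrict_space3) auto
  show ?thesis by measurable
qed

text \<open>Support functions of fuzzy sets belong to this class, which consists of functions
  whose powers are all integrable with respect to a finite measure.\<close>
definition bounded_measurable :: "'a measure \<Rightarrow> ('a \<Rightarrow> real) \<Rightarrow> bool" where
  "bounded_measurable M f \<longleftrightarrow> f \<in> borel_measurable M \<and> (\<exists>c. \<forall>z\<in>space M. \<bar>f z\<bar> \<le> c)"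

lemma bounded_measurableD: "bounded_measurable M f \<Longrightarrow> f \<in> borel_measurable M"
  by (simp add: bounded_measurable_def)

lemma bounded_measurable_lincomb:
  assumes "bounded_measurable M f" "bounded_measurable M g"
  shows "bounded_measurable M (\<lambda>z. a * f z + b * g z)"
proof -
  obtain c d where c: "\<And>z. z \<in> space M \<Longrightarrow> \<bar>f z\<bar> \<le> c" and d: "\<And>z. z \<in> space M \<Longrightarrow> \<bar>g z\<bar> \<le> d"
    using assms by (auto simp: bounded_measurable_def)
  have "\<bar>a * f z + b * g z\<bar> \<le> \<bar>a\<bar> * c + \<bar>b\<bar> * d" if "z \<in> space M" for z
  proof -
    have "\<bar>a * f z + b * g z\<bar> \<le> \<bar>a\<bar> * \<bar>f z\<bar> + \<bar>b\<bar> * \<bar>g z\<bar>"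
      unfolding abs_mult[symmetric] by (rule abs_triangle_ineq)
    also have "\<dots> \<le> \<bar>a\<bar> * c + \<bar>b\<bar> * d" using c[OF that] d[OF that] by (intro add_mono mult_left_mono) auto
    finally show ?thesis .
  qed
  then show ?thesis using assms by (auto simp: bounded_measurable_def)
qed

lemma bounded_measurable_diff:
  assumes "bounded_measurable M f" "bounded_measurable M g"
  shows "bounded_measurable M (\<lambda>z. f z - g z)"
  using bounded_measurable_lincomb[OF assms, of 1 "- 1"] by simp

lemma (in finite_measure) integrable_powr_bounded_measurable:
  assumes "bounded_measurable M f" "0 \<le> s"
  shows "integrable M (\<lambda>z. \<bar>f z\<bar> powr s)"
proof -
  obtain c where c: "\<And>z. z \<in> space M \<Longrightarrow> \<bar>f z\<bar> \<le> c" and [measurable]: "f \<in> borel_measurable M"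
    using assms by (auto simp: bounded_measurable_def)
  show ?thesis
    by (rule integrable_const_bound[where B = "c powr s"])
      (auto intro!: AE_I2 powr_mono2 c assms)
qed

lemma bounded_measurable_supp_fun:
  assumes "A \<in> Fc"
  shows "bounded_measurable sphere_levels (supp_fun A)"
  unfolding bounded_measurable_def
proof (intro conjI exI ballI)
  fix z :: "(real ^ 'a) \<times> real" assume "z \<in> space sphere_levels"
  then obtain u \<alpha> where "z = (u, \<alpha>)" "norm u = 1" "0 \<le> \<alpha>" "\<alpha> \<le> 1"
    by (auto simp: space_sphere_levels)
  then show "\<bar>supp_fun A z\<bar> \<le> set_mag (level A 0)"
    using abs_supp_fun_le[OF assms, of \<alpha> u] by simp
qed (rule measurable_supp_fun_const[OF assms])

lemma bounded_measurable_reflect: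
  assumes "bounded_measurable sphere_levels f"
  shows "bounded_measurable sphere_levels (\<lambda>z. f (- fst z, snd z))"
  using assms measurable_compose[OF measurable_reflect bounded_measurableD[OF assms]]
  by (fastforce simp: bounded_measurable_def split_beta space_sphere_levels)

lemma integral_reflect:
  assumes "f \<in> borel_measurable sphere_levels"
  shows "(\<integral>z. f (- fst z, snd z) \<partial>sphere_levels) = (\<integral>z. f z \<partial>(sphere_levels :: ((real ^ 'n::finite) \<times> real) measure) :: real)"
proof -
  have "(\<integral>z. f z \<partial>(sphere_levels :: ((real ^ 'n) \<times> real) measure))
      = (\<integral>z. f z \<partial>distr sphere_levels sphere_levels (\<lambda>(u, \<alpha>). (- u, \<alpha>)))"
    by (simp add: distr_sphere_levels_reflect)
  also have "\<dots> = (\<integral>z. f (- fst z, snd z) \<partial>sphere_levels)"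
    by (subst integral_distr[OF measurable_reflect assms]) (simp add: split_beta)
  finally show ?thesis ..
qed

lemma mid_conv: "mid f z = 1/2 * f z + (- 1/2) * f (- fst z, snd z)"
  and spr_conv: "spr f z = 1/2 * f z + 1/2 * f (- fst z, snd z)"
  by (cases z; simp add: mid_def spr_def field_simps)+

lemma bounded_measurable_mid: "bounded_measurable sphere_levels f \<Longrightarrow> bounded_measurable sphere_levels (mid f)"
  and bounded_measurable_spr: "bounded_measurable sphere_levels f \<Longrightarrow> bounded_measurable sphere_levels (spr f)"
  unfolding mid_conv[abs_def] spr_conv[abs_def]
  by (intro bounded_measurable_lincomb bounded_measurable_reflect; assumption)+

lemma integrable_sphere_levels:
  assumes "bounded_measurable sphere_levels f" "0 \<le> s"
  shows "integrable sphere_levels (\<lambda>z. \<bar>f z\<bar> powr s)"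
proof -
  interpret prob_space sphere_levels by (rule prob_space_sphere_levels)
  show ?thesis by (rule integrable_powr_bounded_measurable[OF assms])
qed

text \<open>Mid and spread are averages of \<open>f\<close> and of \<open>- f\<close> or \<open>f\<close> reflected in the direction. By convexity and the
  invariance of the measure under the reflection they do not have larger norms than \<open>f\<close>.\<close>
lemma integral_mid_spr_le:
  assumes f: "bounded_measurable sphere_levels f" and s: "1 \<le> s"
  shows "(\<integral>z. \<bar>mid f z\<bar> powr s \<partial>sphere_levels) \<le> (\<integral>z. \<bar>f z\<bar> powr s \<partial>sphere_levels)"
    and "(\<integral>z. \<bar>spr f z\<bar> powr s \<partial>sphere_levels) \<le> (\<integral>z. \<bar>f z\<bar> powr s \<partial>sphere_levels)"
proof -
  note [measurable] = bounded_measurableD[OF f] bounded_measurableD[OF bounded_measurable_reflect[OF f]]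
  have int: "integrable sphere_levels (\<lambda>z. \<bar>f z\<bar> powr s)"
    "integrable sphere_levels (\<lambda>z. \<bar>f (- fst z, snd z)\<bar> powr s)"
    using s f by (intro integrable_sphere_levels bounded_measurable_reflect; simp)+
  have eq: "(\<integral>z. \<bar>f z\<bar> powr s \<partial>sphere_levels)
      = (\<integral>z. 1/2 * \<bar>f z\<bar> powr s + 1/2 * \<bar>f (- fst z, snd z)\<bar> powr s \<partial>sphere_levels)"
    using int integral_reflect[of "\<lambda>z. \<bar>f z\<bar> powr s"] by simp
  have m: "\<bar>mid f z\<bar> powr s \<le> 1/2 * \<bar>f z\<bar> powr s + 1/2 * \<bar>f (- fst z, snd z)\<bar> powr s" for z
    using abs_powr_convex[OF s, of "1/2" "f z" "- f (- fst z, snd z)"] by (simp add: mid_conv)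
  have p: "\<bar>spr f z\<bar> powr s \<le> 1/2 * \<bar>f z\<bar> powr s + 1/2 * \<bar>f (- fst z, snd z)\<bar> powr s" for z
    using abs_powr_convex[OF s, of "1/2" "f z" "f (- fst z, snd z)"] by (simp add: spr_conv)
  show "(\<integral>z. \<bar>mid f z\<bar> powr s \<partial>sphere_levels) \<le> (\<integral>z. \<bar>f z\<bar> powr s \<partial>sphere_levels)"
    unfolding eq using s f int
    by (intro integral_mono m integrable_sphere_levels bounded_measurable_mid) auto
  show "(\<integral>z. \<bar>spr f z\<bar> powr s \<partial>sphere_levels) \<le> (\<integral>z. \<bar>f z\<bar> powr s \<partial>sphere_levels)"
    unfolding eq using s f int
    by (intro integral_mono p integrable_sphere_levels bounded_measurable_spr) auto
qed

lemma Lnorm_nonneg: "0 \<le> Lnorm s f"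
  by (simp add: Lnorm_def)

lemma Lnorm_powr:
  assumes "1 \<le> s"
  shows "Lnorm s f powr s = (\<integral>z. \<bar>f z\<bar> powr s \<partial>sphere_levels)"
  using assms by (simp add: Lnorm_def powr_powr integral_nonneg_AE)

lemma Lnorm_scale:
  assumes "1 \<le> s"
  shows "Lnorm s (\<lambda>z. c * f z) = \<bar>c\<bar> * Lnorm s f"
  using assms unfolding Lnorm_def integral_abs_powr_scale
  by (simp add: powr_mult powr_powr integral_nonneg_AE)

lemma Lnorm_cong_AE:
  assumes "AE z in sphere_levels. f z = g z"
    and "f \<in> borel_measurable sphere_levels" "g \<in> borel_measurable sphere_levels"
  shows "Lnorm s f = Lnorm s g"
  unfolding Lnorm_def using assms
  by (intro arg_cong[where f = "\<lambda>x. x powr (1 / s)"] integral_cong_AE) auto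

lemma Lnorm_add_le:
  assumes "1 \<le> s" "bounded_measurable sphere_levels f" "bounded_measurable sphere_levels g"
  shows "Lnorm s (\<lambda>z. f z + g z) \<le> Lnorm s f + Lnorm s g"
  unfolding Lnorm_def using assms
  by (intro Minkowski_inequality integrable_sphere_levels) (auto simp: bounded_measurableD)

lemma integral_abs_powr_eq_0:
  assumes "bounded_measurable sphere_levels f" "1 \<le> s"
    and "(\<integral>z. \<bar>f z\<bar> powr s \<partial>sphere_levels) = 0"
  shows "AE z in sphere_levels. f z = 0"
proof -
  have "AE z in sphere_levels. \<bar>f z\<bar> powr s = 0"
    using assms integrable_sphere_levels[of f s] by (subst (asm) integral_nonneg_eq_0_iff_AE) auto
  then show ?thesis by simp
qed

section \<open>The metric \<open>rho\<close> and the mean distance to a fuzzy random variable\<close>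

lemma rho_nonneg: "0 \<le> rho r A B"
  by (simp add: rho_def Lnorm_nonneg)

lemma rho_commute: "rho r A B = rho r B A"
  by (simp add: rho_def Lnorm_def abs_minus_commute)

lemma rho_triangle:
  assumes "1 \<le> r" "A \<in> Fc" "B \<in> Fc" "C \<in> Fc"
  shows "rho r A C \<le> rho r A B + rho r B C"
  using Lnorm_add_le[of r "\<lambda>z. supp_fun A z - supp_fun B z" "\<lambda>z. supp_fun B z - supp_fun C z"] assms
  by (simp add: rho_def bounded_measurable_diff bounded_measurable_supp_fun)

text \<open>The hypothesis on \<open>W\<close> concerns support functions up to null sets. It is satisfied by convex combinations
  of fuzzy sets and also by the points of metric segments, which need not be such combinations a priori.\<close>
lemma rho_convex:
  assumes r: "1 \<le> r" and Fc: "A \<in> Fc" "V \<in> Fc" "W \<in> Fc" "Y \<in> Fc" and t: "0 \<le> t" "t \<le> 1"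
    and W: "AE z in sphere_levels. supp_fun W z = (1 - t) * supp_fun A z + t * supp_fun V z"
  shows "rho r W Y \<le> (1 - t) * rho r A Y + t * rho r V Y"
proof -
  let ?f = "\<lambda>z. supp_fun A z - supp_fun Y z" and ?g = "\<lambda>z. supp_fun V z - supp_fun Y z"
  have bm: "bounded_measurable sphere_levels ?f" "bounded_measurable sphere_levels ?g"
    "bounded_measurable sphere_levels (\<lambda>z. supp_fun W z - supp_fun Y z)"
    using Fc by (intro bounded_measurable_diff bounded_measurable_supp_fun; simp)+
  have bs: "bounded_measurable sphere_levels (\<lambda>z. (1 - t) * ?f z)" "bounded_measurable sphere_levels (\<lambda>z. t * ?g z)"
    using bounded_measurable_lincomb[OF bm(1) bm(1), of "1 - t" 0]
      bounded_measurable_lincomb[OF bm(2) bm(2), of t 0] by simp_all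
  have "rho r W Y = Lnorm r (\<lambda>z. (1 - t) * ?f z + t * ?g z)"
    unfolding rho_def
  proof (rule Lnorm_cong_AE)
    show "AE z in sphere_levels. supp_fun W z - supp_fun Y z = (1 - t) * ?f z + t * ?g z"
      using W by eventually_elim (simp add: algebra_simps)
  qed (use bm bounded_measurable_lincomb[OF bm(1,2)] in \<open>auto intro: bounded_measurableD\<close>)
  also have "\<dots> \<le> Lnorm r (\<lambda>z. (1 - t) * ?f z) + Lnorm r (\<lambda>z. t * ?g z)"
    by (rule Lnorm_add_le[OF r bs])
  also have "\<dots> = (1 - t) * rho r A Y + t * rho r V Y"
    using t r by (simp only: Lnorm_scale rho_def)
  finally show ?thesis .
qed

lemma rho_le_set_mag:
  assumes r: "1 \<le> r" and A: "A \<in> Fc" and B: "B \<in> Fc"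
  shows "rho r A B \<le> set_mag (level A 0) + set_mag (level B 0)"
proof -
  interpret prob_space sphere_levels by (rule prob_space_sphere_levels)
  let ?c = "set_mag (level A 0) + set_mag (level B 0)"
  have c: "0 \<le> ?c" using set_mag_nonneg[OF A] set_mag_nonneg[OF B] by simp
  have le: "\<bar>supp_fun A z - supp_fun B z\<bar> \<le> ?c" if z: "z \<in> space sphere_levels" for z
  proof -
    obtain u \<alpha> where "z = (u, \<alpha>)" "norm u = 1" "0 \<le> \<alpha>" "\<alpha> \<le> 1"
      using z by (auto simp: space_sphere_levels)
    then show ?thesis
      using abs_supp_fun_le[OF A, of \<alpha> u] abs_supp_fun_le[OF B, of \<alpha> u] by simp
  qed
  have "(\<integral>z. \<bar>supp_fun A z - supp_fun B z\<bar> powr r \<partial>sphere_levels) \<le> (\<integral>z. ?c powr r \<partial>(sphere_levels :: ((real ^ 'a) \<times> real) measure))"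
    using r A B le by (intro integral_mono integrable_sphere_levels bounded_measurable_diff
        bounded_measurable_supp_fun powr_mono2) auto
  also have "\<dots> = ?c powr r" by (simp add: prob_space)
  finally have "rho r A B \<le> (?c powr r) powr (1 / r)"
    unfolding rho_def Lnorm_def using r by (intro powr_mono2) (auto simp: integral_nonneg_AE)
  also have "\<dots> = ?c" using r c by (simp add: powr_powr)
  finally show ?thesis .
qed

lemma measurable_rho:
  assumes X: "fuzzy_rv P X" and A: "A \<in> Fc"
  shows "(\<lambda>\<omega>. rho r A (X \<omega>)) \<in> borel_measurable P"
proof -
  interpret prob_space sphere_levels by (rule prob_space_sphere_levels)
  note [measurable] = measurable_supp_fun[OF X] measurable_supp_fun_const[OF A]
  have "(\<lambda>(\<omega>, z). \<bar>supp_fun A z - supp_fun (X \<omega>) z\<bar> powr r) \<in> borel_measurable (P \<Otimes>\<^sub>M sphere_levels)"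
    by measurable
  from borel_measurable_lebesgue_integral[OF this]
  show ?thesis unfolding rho_def Lnorm_def by measurable
qed

text \<open>The distance to \<open>X\<close> is dominated by the magnitudes of the supports of \<open>A\<close> and \<open>X\<close>.\<close>
lemma integrable_rho_powr:
  assumes X: "X \<in> Lr_fuzzy P r" and r: "1 \<le> r" "1 \<le> q" and A: "A \<in> Fc" and P: "prob_space P"
  shows "integrable P (\<lambda>\<omega>. rho q A (X \<omega>) powr r)"
proof -
  interpret prob_space P by (rule P)
  let ?a = "set_mag (level A 0)" and ?m = "\<lambda>\<omega>. set_mag (level (X \<omega>) 0)"
  have rv: "fuzzy_rv P X" and int: "integrable P (\<lambda>\<omega>. ?m \<omega> powr r)"
    using X by (auto simp: Lr_fuzzy_def)
  note [measurable] = measurable_rho[OF rv A, of q]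
  show ?thesis
  proof (rule Bochner_Integration.integrable_bound)
    show "integrable P (\<lambda>\<omega>. 1/2 * (2 * ?a) powr r + 1/2 * (2 powr r * ?m \<omega> powr r))"
      using int by simp
    show "AE \<omega> in P. norm (rho q A (X \<omega>) powr r) \<le> norm (1/2 * (2 * ?a) powr r + 1/2 * (2 powr r * ?m \<omega> powr r))"
    proof (rule AE_I2)
      fix \<omega> assume "\<omega> \<in> space P"
      then have F: "X \<omega> \<in> Fc" by (rule fuzzy_rv_Fc[OF rv])
      have nn: "0 \<le> ?a" "0 \<le> ?m \<omega>" using A F by (auto intro: set_mag_nonneg)
      have "rho q A (X \<omega>) powr r \<le> (?a + ?m \<omega>) powr r"
        using rho_le_set_mag[OF r(2) A F] r by (intro powr_mono2) (auto simp: rho_nonneg)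
      also have "\<dots> \<le> 1/2 * (2 * ?a) powr r + 1/2 * (2 * ?m \<omega>) powr r"
        using abs_powr_convex[OF r(1), of "1/2" "2 * ?a" "2 * ?m \<omega>"] nn by simp
      finally show "norm (rho q A (X \<omega>) powr r) \<le> norm (1/2 * (2 * ?a) powr r + 1/2 * (2 powr r * ?m \<omega> powr r))"
        using nn by (simp add: powr_mult)
    qed
  qed measurable
qed

lemma Lr_fuzzy_subset_L1:
  assumes r: "1 \<le> r" and P: "prob_space P"
  shows "Lr_fuzzy P r \<subseteq> Lr_fuzzy P 1"
proof
  fix X :: "'a \<Rightarrow> 'b fuzzy" assume X: "X \<in> Lr_fuzzy P r"
  interpret prob_space P by (rule P)
  let ?m = "\<lambda>\<omega>. set_mag (level (X \<omega>) 0)"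
  have rv: "fuzzy_rv P X" and int: "integrable P (\<lambda>\<omega>. ?m \<omega> powr r)"
    using X by (auto simp: Lr_fuzzy_def)
  have nn: "0 \<le> ?m \<omega>" if "\<omega> \<in> space P" for \<omega> using set_mag_nonneg[OF fuzzy_rv_Fc[OF rv that]] .
  have "integrable P (\<lambda>\<omega>. ?m \<omega> powr 1)"
  proof (rule Bochner_Integration.integrable_bound)
    show "integrable P (\<lambda>\<omega>. 1 + ?m \<omega> powr r)" using int by simp
    have "(\<lambda>\<omega>. (?m \<omega> powr r) powr (1 / r)) \<in> borel_measurable P"
      using borel_measurable_integrable[OF int] by measurable
    then show "(\<lambda>\<omega>. ?m \<omega> powr 1) \<in> borel_measurable P"
      by (rule measurable_cong[THEN iffD1, rotated]) (use r nn in \<open>simp add: powr_powr\<close>)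
    show "AE \<omega> in P. norm (?m \<omega> powr 1) \<le> norm (1 + ?m \<omega> powr r)"
    proof (rule AE_I2)
      fix \<omega> assume "\<omega> \<in> space P"
      then have "?m \<omega> powr 1 \<le> 1 + ?m \<omega> powr r"
        using r nn by (intro powr_le_one_plus_powr) auto
      then show "norm (?m \<omega> powr 1) \<le> norm (1 + ?m \<omega> powr r)" by simp
    qed
  qed
  with rv show "X \<in> Lr_fuzzy P 1" by (simp add: Lr_fuzzy_def)
qed

section \<open>Metric segments\<close>

text \<open>A form of the equality case that includes the degenerate situations: \<open>t = 0\<close> if the norm \<open>a\<close> of \<open>f\<close>
  is 0, \<open>t = 1\<close> if the norm \<open>b\<close> of \<open>g\<close> is 0, and \<open>t = a / (a + b)\<close> otherwise.\<close>
lemma Minkowski_equality_segment: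
  fixes f1 f2 g1 g2 :: "(real ^ 'n::finite) \<times> real \<Rightarrow> real"
  assumes s: "1 < s" and \<theta>: "0 \<le> \<theta>"
    and bm: "bounded_measurable sphere_levels f1" "bounded_measurable sphere_levels g1"
      "bounded_measurable sphere_levels f2" "bounded_measurable sphere_levels g2"
    and eq: "((\<integral>z. \<bar>f1 z + g1 z\<bar> powr s \<partial>sphere_levels) + \<theta> * (\<integral>z. \<bar>f2 z + g2 z\<bar> powr s \<partial>sphere_levels)) powr (1 / s)
      = ((\<integral>z. \<bar>f1 z\<bar> powr s \<partial>sphere_levels) + \<theta> * (\<integral>z. \<bar>f2 z\<bar> powr s \<partial>sphere_levels)) powr (1 / s)
      + ((\<integral>z. \<bar>g1 z\<bar> powr s \<partial>sphere_levels) + \<theta> * (\<integral>z. \<bar>g2 z\<bar> powr s \<partial>sphere_levels)) powr (1 / s)"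
  obtains t where "0 \<le> t" "t \<le> 1" "AE z in sphere_levels. (1 - t) * f1 z = t * g1 z"
    "0 < \<theta> \<Longrightarrow> AE z in sphere_levels. (1 - t) * f2 z = t * g2 z"
proof -
  define I where "I = (\<lambda>f. \<integral>z. \<bar>f z\<bar> powr s \<partial>(sphere_levels :: ((real ^ 'n) \<times> real) measure))"
  have I: "0 \<le> I f" for f by (simp add: I_def integral_nonneg_AE)
  define a b where "a = (I f1 + \<theta> * I f2) powr (1 / s)" and "b = (I g1 + \<theta> * I g2) powr (1 / s)"
  have ab: "0 \<le> a" "0 \<le> b" by (simp_all add: a_def b_def)
  have nn: "0 \<le> I f + \<theta> * I g" for f g using I \<theta> by (simp add: add_nonneg_nonneg)
  have as: "I f1 + \<theta> * I f2 = a powr s" and bs: "I g1 + \<theta> * I g2 = b powr s"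
    using nn s by (simp_all add: a_def b_def powr_powr)
  have abs: "I (\<lambda>z. f1 z + g1 z) + \<theta> * I (\<lambda>z. f2 z + g2 z) = (a + b) powr s"
  proof -
    have "(I (\<lambda>z. f1 z + g1 z) + \<theta> * I (\<lambda>z. f2 z + g2 z)) powr (1 / s) = a + b"
      using eq by (simp add: I_def a_def b_def)
    then have "((I (\<lambda>z. f1 z + g1 z) + \<theta> * I (\<lambda>z. f2 z + g2 z)) powr (1 / s)) powr s = (a + b) powr s"
      by simp
    then show ?thesis using nn s by (simp add: powr_powr)
  qed
  have zero: "AE z in sphere_levels. f z = 0" "0 < \<theta> \<Longrightarrow> AE z in sphere_levels. g z = 0"
    if "I f + \<theta> * I g = 0" "bounded_measurable sphere_levels f" "bounded_measurable sphere_levels g" for f g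
  proof -
    have "I f = 0" "\<theta> * I g = 0" using that I[of f] I[of g] \<theta> by (simp_all add: add_nonneg_eq_0_iff)
    then show "AE z in sphere_levels. f z = 0" "0 < \<theta> \<Longrightarrow> AE z in sphere_levels. g z = 0"
      using s that by (auto simp: I_def intro!: integral_abs_powr_eq_0[of _ s])
  qed
  consider "a = 0" | "b = 0" | "0 < a" "0 < b" using ab by linarith
  then show ?thesis
  proof cases
    case 1
    then show ?thesis using zero[of f1 f2] as bm by (intro that[of 0]) auto
  next
    case 2
    then show ?thesis using zero[of g1 g2] bs bm by (intro that[of 1]) auto
  next
    case 3
    note ints = integrable_sphere_levels[OF bm(1), of s] integrable_sphere_levels[OF bm(2), of s]
      integrable_sphere_levels[OF bm(3), of s] integrable_sphere_levels[OF bm(4), of s]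
    note E = Minkowski_equality[OF s \<theta> bm[THEN bounded_measurableD] ints 3
        as[unfolded I_def] bs[unfolded I_def] abs[unfolded I_def]]
    define t where "t = a / (a + b)"
    have t: "0 \<le> t" "t \<le> 1" "1 - t = b / (a + b)" using 3 by (auto simp: t_def field_simps)
    have *: "(1 - t) * x = t * y" if "x / a = y / b" for x y
      using 3 that unfolding t(3) t_def by (simp add: field_simps)
    have s0: "0 \<le> s" using s by simp
    show ?thesis
      by (rule that[OF t(1,2) AE_mp[OF E(1) AE_I2] AE_mp[OF E(2) AE_I2]]) (use s0 * in auto)
  qed
qed

lemma mid_diff: "mid f z - mid g z = mid (\<lambda>z. f z - g z) z"
  and spr_diff: "spr f z - spr g z = spr (\<lambda>z. f z - g z) z"
  by (simp_all add: mid_conv spr_conv field_simps)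

text \<open>Apply the equality case to the differences of the support functions of \<open>A\<close> and \<open>U\<close> and of \<open>U\<close> and \<open>V\<close>. For
  \<open>dmetric\<close> it yields proportionality of the mids and of the spreads, with the same factor because both
  come from one norm; a function is the sum of its mid and its spread, so it
  inherits the proportionality.\<close>
lemma metric_segment:
  assumes s: "1 < s" and \<theta>: "0 < \<theta>" and d: "d \<in> {rho s, dmetric s \<theta>}"
    and Fc: "A \<in> Fc" "U \<in> Fc" "V \<in> Fc" and eq: "d A V = d A U + d U V"
  obtains t where "0 \<le> t" "t \<le> 1"
    "AE z in sphere_levels. supp_fun U z = (1 - t) * supp_fun A z + t * supp_fun V z"
proof -
  let ?f = "\<lambda>z. supp_fun A z - supp_fun U z" and ?g = "\<lambda>z. supp_fun U z - supp_fun V z"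
  have bm: "bounded_measurable sphere_levels ?f" "bounded_measurable sphere_levels ?g"
    using Fc by (intro bounded_measurable_diff bounded_measurable_supp_fun; simp)+
  have s': "1 \<le> s" using s by simp
  obtain t where t: "0 \<le> t" "t \<le> 1" and ae: "AE z in sphere_levels. (1 - t) * ?f z = t * ?g z"
  proof (cases "d = rho s")
    case True
    show ?thesis
      by (rule Minkowski_equality_segment[of s 0 ?f ?g ?f ?g])
        (use s bm eq that in \<open>auto simp: True rho_def Lnorm_def\<close>)
  next
    case False
    then have d: "d = dmetric s \<theta>" using d by simp
    have sum: "mid ?f z + mid ?g z = mid (\<lambda>z. supp_fun A z - supp_fun V z) z"
      "spr ?f z + spr ?g z = spr (\<lambda>z. supp_fun A z - supp_fun V z) z" for z
      by (simp_all add: mid_conv spr_conv field_simps)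
    obtain t where t: "0 \<le> t" "t \<le> 1"
      and ae: "AE z in sphere_levels. (1 - t) * mid ?f z = t * mid ?g z"
        "AE z in sphere_levels. (1 - t) * spr ?f z = t * spr ?g z"
      by (rule Minkowski_equality_segment[of s \<theta> "mid ?f" "mid ?g" "spr ?f" "spr ?g"])
        (use s \<theta> bm eq in \<open>auto simp: d dmetric_def Lnorm_powr[OF s'] mid_diff spr_diff sum
          intro: bounded_measurable_mid bounded_measurable_spr\<close>)
    from ae have "AE z in sphere_levels. (1 - t) * ?f z = t * ?g z"
    proof eventually_elim
      case (elim z)
      have ms: "f z = mid f z + spr f z" for f :: "(real ^ 'a) \<times> real \<Rightarrow> real"
        by (simp add: mid_conv spr_conv)
      show ?case using elim by (subst ms[of ?f], subst ms[of ?g]) (simp only: distrib_left)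
    qed
    with t show ?thesis by (rule that)
  qed
  from ae have "AE z in sphere_levels. supp_fun U z = (1 - t) * supp_fun A z + t * supp_fun V z"
    by eventually_elim (simp add: algebra_simps)
  with t show ?thesis by (rule that)
qed

section \<open>Divergence in the metrics\<close>

text \<open>The bound serves only to compare divergence, so the crude bound \<open>x powr s \<le> 1 + x powr r\<close> can
  replace the monotonicity of the norms in the exponent.\<close>
lemma metric_le_rho:
  assumes s: "1 \<le> s" "s \<le> r" and \<theta>: "0 < \<theta>" and d: "d \<in> {rho s, dmetric s \<theta>}"
    and A: "A \<in> Fc" and B: "B \<in> Fc"
  shows "d A B \<le> ((1 + \<theta>) * (1 + rho r A B powr r)) powr (1 / s)"
proof -
  interpret prob_space sphere_levels by (rule prob_space_sphere_levels)
  let ?f = "\<lambda>z. supp_fun A z - supp_fun B z"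
  have bm: "bounded_measurable sphere_levels ?f"
    using A B by (intro bounded_measurable_diff bounded_measurable_supp_fun)
  define I where "I = (\<integral>z. \<bar>?f z\<bar> powr s \<partial>sphere_levels)"
  have I0: "0 \<le> I" by (simp add: I_def integral_nonneg_AE)
  have pt: "\<bar>?f z\<bar> powr s \<le> 1 + \<bar>?f z\<bar> powr r" for z
    using s by (intro powr_le_one_plus_powr) auto
  have "I \<le> (\<integral>z. 1 + \<bar>?f z\<bar> powr r \<partial>sphere_levels)"
    unfolding I_def using s bm
    by (intro integral_mono pt Bochner_Integration.integrable_add integrable_sphere_levels) auto
  also have "\<dots> = 1 + rho r A B powr r"
    using s integrable_sphere_levels[OF bm, of r] by (simp add: rho_def Lnorm_powr prob_space)
  finally have I: "I \<le> 1 + rho r A B powr r" .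
  have "d A B \<le> ((1 + \<theta>) * I) powr (1 / s)"
  proof (cases "d = rho s")
    case True
    have "1 * I \<le> (1 + \<theta>) * I" using \<theta> I0 by (intro mult_right_mono) auto
    then have "I powr (1 / s) \<le> ((1 + \<theta>) * I) powr (1 / s)"
      using s I0 by (intro powr_mono2) auto
    then show ?thesis by (simp add: True rho_def Lnorm_def I_def)
  next
    case False
    then have d: "d = dmetric s \<theta>" using d by simp
    have "(\<integral>z. \<bar>mid ?f z\<bar> powr s \<partial>sphere_levels) + \<theta> * (\<integral>z. \<bar>spr ?f z\<bar> powr s \<partial>sphere_levels) \<le> I + \<theta> * I"
      unfolding I_def using \<theta> by (intro add_mono mult_left_mono integral_mid_spr_le bm s) auto
    then have "((\<integral>z. \<bar>mid ?f z\<bar> powr s \<partial>sphere_levels) + \<theta> * (\<integral>z. \<bar>spr ?f z\<bar> powr s \<partial>sphere_levels)) powr (1 / s)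
        \<le> (I + \<theta> * I) powr (1 / s)"
      using s \<theta> by (intro powr_mono2) (auto intro!: add_nonneg_nonneg mult_nonneg_nonneg simp: integral_nonneg_AE)
    then show ?thesis
      by (simp add: d dmetric_def Lnorm_powr[OF s(1)] mid_diff spr_diff distrib_right)
  qed
  also have "\<dots> \<le> ((1 + \<theta>) * (1 + rho r A B powr r)) powr (1 / s)"
    using s \<theta> I I0 by (intro powr_mono2 mult_left_mono) auto
  finally show ?thesis .
qed

lemma rho_at_top:
  assumes s: "1 \<le> s" "s \<le> r" and \<theta>: "0 < \<theta>" and d: "d \<in> {rho s, dmetric s \<theta>}"
    and A: "A \<in> Fc" and B: "\<And>n. B n \<in> Fc"
    and lim: "filterlim (\<lambda>n. d (B n) A) at_top F"
  shows "filterlim (\<lambda>n. rho r (B n) A) at_top F"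
  unfolding filterlim_at_top
proof
  fix Z
  define c where "c = ((1 + \<theta>) * (1 + \<bar>Z\<bar> powr r)) powr (1 / s)"
  have "eventually (\<lambda>n. c < d (B n) A) F"
    using lim by (simp add: filterlim_at_top_dense)
  then show "eventually (\<lambda>n. Z \<le> rho r (B n) A) F"
  proof eventually_elim
    case (elim n)
    show ?case
    proof (rule ccontr)
      assume "\<not> ?thesis"
      then have "rho r (B n) A powr r \<le> \<bar>Z\<bar> powr r"
        using s by (intro powr_mono2) (auto simp: rho_nonneg)
      then have "((1 + \<theta>) * (1 + rho r (B n) A powr r)) powr (1 / s) \<le> c"
        unfolding c_def using s \<theta> by (intro powr_mono2 mult_left_mono) auto
      with metric_le_rho[OF s \<theta> d B A, of n] elim show False by simp
    qed
  qed
qed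

text \<open>Under the projection \<open>sgn\<close>, which defines the measure on the sphere, the open hemisphere corresponds
  to the intersection of the unit ball with an open halfspace, and this contains a ball.\<close>
lemma emeasure_sphere_measure_halfspace:
  fixes x :: "real ^ 'n::finite"
  assumes "x \<noteq> 0"
  shows "emeasure sphere_measure {u \<in> sphere 0 1. 0 < u \<bullet> x} \<noteq> 0"
proof -
  let ?H = "{u \<in> sphere 0 1. 0 < u \<bullet> x}"
  have H: "?H \<in> sets borel"
  proof -
    have "?H = sphere 0 1 \<inter> {u. 0 < u \<bullet> x}" by auto
    moreover have "open {u. 0 < u \<bullet> x}" by (intro open_Collect_less continuous_intros)
    ultimately show ?thesis by auto
  qed
  have "sgn y \<in> ?H \<longleftrightarrow> 0 < y \<bullet> x" for y
  proof (cases "y = 0")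
    case False
    then have "0 < sgn y \<bullet> x \<longleftrightarrow> 0 < y \<bullet> x" by (simp add: sgn_div_norm zero_less_mult_iff)
    with False show ?thesis by (simp add: norm_sgn)
  qed simp
  then have "ball 0 1 \<inter> sgn -` ?H = ball 0 1 \<inter> {y. 0 < y \<bullet> x}" by blast
  moreover have "emeasure lborel (ball 0 1 \<inter> {y. 0 < y \<bullet> x}) \<noteq> 0"
  proof -
    have op: "open (ball 0 1 \<inter> {y. 0 < y \<bullet> x})"
      by (intro open_Int open_ball open_Collect_less continuous_intros)
    have "(1 / (2 * norm x)) *\<^sub>R x \<in> ball 0 1 \<inter> {y. 0 < y \<bullet> x}"
      using assms by simp
    then obtain e where e: "0 < e" "ball ((1 / (2 * norm x)) *\<^sub>R x) e \<subseteq> ball 0 1 \<inter> {y. 0 < y \<bullet> x}"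
      using op by (meson open_contains_ball)
    have "unit_ball_vol (real CARD('n)) > 0" by (rule unit_ball_vol_pos) simp
    then have "0 < emeasure lborel (ball ((1 / (2 * norm x)) *\<^sub>R x) e)"
      using e by (simp add: emeasure_ball)
    also have "\<dots> \<le> emeasure lborel (ball 0 1 \<inter> {y. 0 < y \<bullet> x})"
      using e op by (intro emeasure_mono) auto
    finally show ?thesis by simp
  qed
  ultimately show ?thesis
    using emeasure_unit_ball[where 'n='n] by (subst emeasure_sphere_measure[OF H]) (auto simp: ennreal_divide_eq_0_iff)
qed

text \<open>If \<open>U\<close> is not the indicator of the origin, then \<open>U x > 0\<close> for some \<open>x \<noteq> 0\<close>: otherwise the non-empty level 1
  would be the origin alone. Then \<open>supp_fun U (u, \<alpha>) \<ge> u \<bullet> x > 0\<close> for all directions in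
  an open hemisphere and all levels up to \<open>U x\<close>, a set of positive measure.\<close>
lemma Lnorm_supp_fun_pos:
  fixes U :: "'n::finite fuzzy"
  assumes U: "U \<in> Fc" "U \<noteq> indicator {0}" and r: "1 \<le> r"
  shows "0 < Lnorm r (supp_fun U)"
proof (rule ccontr)
  assume "\<not> ?thesis"
  then have "Lnorm r (supp_fun U) = 0" using Lnorm_nonneg[of r "supp_fun U"] by simp
  then have "(\<integral>z. \<bar>supp_fun U z\<bar> powr r \<partial>sphere_levels) = 0" using r by (simp flip: Lnorm_powr)
  then have ae: "AE z in sphere_levels. supp_fun U z = 0"
    by (rule integral_abs_powr_eq_0[OF bounded_measurable_supp_fun[OF U(1)] r])
  have "\<exists>x. x \<noteq> 0 \<and> 0 < U x"
  proof (rule ccontr)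
    assume "\<nexists>x. x \<noteq> 0 \<and> 0 < U x"
    then have nex: "\<not> 0 < U y" if "y \<noteq> 0" for y using that by blast
    have z: "U y = 0" if "y \<noteq> 0" for y
      using nex[of y] that Fc_range(1)[OF U(1), of y] by linarith
    obtain y where "y \<in> level U 1" using level_Fc(1)[OF U(1), of 1] by auto
    then have "U y = 1" using Fc_range(2)[OF U(1), of y] by (simp add: level_pos)
    with z[of y] have "U 0 = 1" by (cases "y = 0") auto
    with z have "U = indicator {0}" by (auto simp: indicator_def)
    with U(2) show False ..
  qed
  then obtain x where x: "x \<noteq> 0" "0 < U x" by blast
  let ?H = "{u \<in> sphere 0 1. 0 < u \<bullet> x}"
  let ?L = "restrict_space lborel {0..1::real}"
  interpret L: prob_space ?L by (intro prob_space_restrict_space) auto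
  have H: "?H \<in> sets sphere_measure"
  proof -
    have "open {u. 0 < u \<bullet> x}" by (intro open_Collect_less continuous_intros)
    then have "{u. 0 < u \<bullet> x} \<in> sets borel" by simp
    moreover have "?H = sphere 0 1 \<inter> {u. 0 < u \<bullet> x}" by blast
    ultimately show ?thesis
      unfolding sets_sphere_measure sets_restrict_space by (rule rev_image_eqI)
  qed
  have Ux: "U x \<le> 1" using U by (intro Fc_range)
  have J: "{0..U x} \<in> sets ?L" "emeasure ?L {0..U x} = U x"
    using Ux x by (auto simp: sets_restrict_space_iff emeasure_restrict_space)
  have "AE z in sphere_levels. z \<notin> ?H \<times> {0..U x}"
    using ae
  proof (eventually_elim, clarify)
    fix u \<alpha> assume z: "supp_fun U (u, \<alpha>) = 0" "u \<in> sphere 0 1" "0 < u \<bullet> x" "\<alpha> \<in> {0..U x}"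
    have "x \<in> level U \<alpha>" using level_antimono[of \<alpha> "U x" U] x z by (auto simp: level_pos)
    then have "u \<bullet> x \<le> supp_fun U (u, \<alpha>)" using U z Ux by (intro supp_fun_upper) auto
    with z show False by simp
  qed
  then have "?H \<times> {0..U x} \<in> null_sets sphere_levels"
    using H J by (subst AE_iff_null_sets) auto
  then have "emeasure sphere_measure ?H * ennreal (U x) = 0"
    using L.emeasure_pair_measure_Times[OF H J(1)] J(2) by (simp add: null_setsD1)
  with emeasure_sphere_measure_halfspace[OF x(1)] x show False by simp
qed

section \<open>Depths given by convex and coercive costs\<close>

lemma supp_fun_add_scale:
  assumes A: "A \<in> Fc" and U: "U \<in> Fc" and ab: "0 \<le> a" "0 \<le> b" and z: "z \<in> space sphere_levels"
  shows "supp_fun (a \<odot>\<^sub>F A \<oplus>\<^sub>F b \<odot>\<^sub>F U) z = a * supp_fun A z + b * supp_fun U z"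
    and "supp_fun (A \<oplus>\<^sub>F b \<odot>\<^sub>F U) z = supp_fun A z + b * supp_fun U z"
proof -
  obtain u \<alpha> where "z = (u, \<alpha>)" "0 \<le> \<alpha>" "\<alpha> \<le> 1" using z by (auto simp: space_sphere_levels)
  then show "supp_fun (a \<odot>\<^sub>F A \<oplus>\<^sub>F b \<odot>\<^sub>F U) z = a * supp_fun A z + b * supp_fun U z"
    "supp_fun (A \<oplus>\<^sub>F b \<odot>\<^sub>F U) z = supp_fun A z + b * supp_fun U z"
    using ab A U by (simp_all add: supp_fun_add supp_fun_scale fuzzy_scale_Fc)
qed

lemma rho_add_scale:
  assumes A: "A \<in> Fc" and U: "U \<in> Fc" and b: "0 \<le> b" and r: "1 \<le> r"
  shows "rho r (A \<oplus>\<^sub>F b \<odot>\<^sub>F U) A = b * Lnorm r (supp_fun U)"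
proof -
  have "rho r (A \<oplus>\<^sub>F b \<odot>\<^sub>F U) A = Lnorm r (\<lambda>z. b * supp_fun U z)"
    unfolding rho_def Lnorm_def
    using supp_fun_add_scale(2)[OF A U b b]
    by (intro arg_cong[where f = "\<lambda>x. x powr (1 / r)"] Bochner_Integration.integral_cong) auto
  also have "\<dots> = b * Lnorm r (supp_fun U)" using b r by (simp add: Lnorm_scale)
  finally show ?thesis .
qed

text \<open>The common argument for both depths. Convexity is required along all triples that are
  collinear in the sense of support functions, almost everywhere, so that it applies to metric segments, too.\<close>
lemma depth_of_convex_coercive_cost:
  fixes C :: "'n::finite fuzzy \<Rightarrow> real"
  assumes nonneg: "\<And>B. B \<in> Fc \<Longrightarrow> 0 \<le> C B"
    and convex: "\<And>A V W t. A \<in> Fc \<Longrightarrow> V \<in> Fc \<Longrightarrow> W \<in> Fc \<Longrightarrow> 0 \<le> t \<Longrightarrow> t \<le> 1 \<Longrightarrow>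
      AE z in sphere_levels. supp_fun W z = (1 - t) * supp_fun A z + t * supp_fun V z \<Longrightarrow>
      C W \<le> (1 - t) * C A + t * C V"
    and coercive: "\<And>B. B \<in> Fc \<Longrightarrow> rho r B A \<le> C B + K"
    and r: "1 \<le> r" and A: "A \<in> Fc" and max: "inverse (1 + C A) = (SUP B\<in>Fc. inverse (1 + C B))"
  shows "(\<forall>t\<in>{0..1}. \<forall>U\<in>Fc.
        inverse (1 + C A) \<ge> inverse (1 + C ((1 - t) \<odot>\<^sub>F A \<oplus>\<^sub>F t \<odot>\<^sub>F U)) \<and>
        inverse (1 + C ((1 - t) \<odot>\<^sub>F A \<oplus>\<^sub>F t \<odot>\<^sub>F U)) \<ge> inverse (1 + C U))
     \<and> (\<forall>U\<in>Fc - {indicator {0}}. ((\<lambda>t. inverse (1 + C (A \<oplus>\<^sub>F t \<odot>\<^sub>F U))) \<longlongrightarrow> 0) at_top)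
     \<and> (\<forall>s>1. \<forall>\<theta>>0. \<forall>d\<in>{rho s, dmetric s \<theta>}. \<forall>U\<in>Fc. \<forall>V\<in>Fc.
        d A V = d A U + d U V \<longrightarrow> inverse (1 + C A) \<ge> inverse (1 + C U) \<and> inverse (1 + C U) \<ge> inverse (1 + C V))
     \<and> (\<forall>s\<in>{1..r}. \<forall>\<theta>>0. \<forall>d\<in>{rho s, dmetric s \<theta>}. \<forall>A' :: nat \<Rightarrow> 'n fuzzy.
        (\<forall>n. A' n \<in> Fc) \<and> filterlim (\<lambda>n. d (A' n) A) at_top sequentially \<longrightarrow>
        (\<lambda>n. inverse (1 + C (A' n))) \<longlonglongrightarrow> 0)"
proof -
  have inv: "inverse (1 + C B) \<le> inverse (1 + C B') \<longleftrightarrow> C B' \<le> C B" if "B \<in> Fc" "B' \<in> Fc" for B B'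
    using nonneg[OF that(1)] nonneg[OF that(2)] by (simp add: inverse_le_iff_le add_pos_nonneg)
  have "bdd_above ((\<lambda>B. inverse (1 + C B)) ` Fc)"
    using nonneg by (intro bdd_aboveI2[of _ _ 1]) (simp add: inverse_le_1_iff)
  then have min: "C A \<le> C B" if "B \<in> Fc" for B
    using cSUP_upper[of B Fc "\<lambda>B. inverse (1 + C B)"] inv[OF that A] that max by simp
  have mono: "C A \<le> C W \<and> C W \<le> C V"
    if "V \<in> Fc" "W \<in> Fc" "0 \<le> t" "t \<le> 1"
      "AE z in sphere_levels. supp_fun W z = (1 - t) * supp_fun A z + t * supp_fun V z" for V W t
  proof -
    have "C W \<le> (1 - t) * C A + t * C V" by (rule convex[OF A that])
    also have "\<dots> \<le> (1 - t) * C V + t * C V" using min[of V] that by (intro add_mono mult_left_mono) auto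
    finally show ?thesis using min[of W] that by (simp add: algebra_simps)
  qed
  have tendsto0: "((\<lambda>i. inverse (1 + C (B i))) \<longlongrightarrow> 0) F"
    if "filterlim (\<lambda>i. rho r (B i) A) at_top F" "eventually (\<lambda>i. B i \<in> Fc) F"
    for B :: "'i \<Rightarrow> 'n fuzzy" and F
  proof -
    have "filterlim (\<lambda>i. (1 - K) + rho r (B i) A) at_top F"
      by (intro filterlim_tendsto_add_at_top[OF tendsto_const] that)
    then have "filterlim (\<lambda>i. 1 + C (B i)) at_top F"
      by (rule filterlim_at_top_mono)
        (use that(2) in eventually_elim, use coercive in \<open>simp add: algebra_simps\<close>)
    then show ?thesis by (rule tendsto_inverse_0_at_top)
  qed
  show ?thesis
  proof (intro conjI ballI allI impI)
    fix t :: real and U :: "'n fuzzy" assume t: "t \<in> {0..1}" and U: "U \<in> Fc"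
    let ?W = "(1 - t) \<odot>\<^sub>F A \<oplus>\<^sub>F t \<odot>\<^sub>F U"
    have W: "?W \<in> Fc" using A U by (intro fuzzy_add_Fc fuzzy_scale_Fc)
    have "C A \<le> C ?W \<and> C ?W \<le> C U"
      using t A U by (intro mono[OF U W, of t] AE_I2 supp_fun_add_scale(1)) auto
    then show "inverse (1 + C ?W) \<le> inverse (1 + C A)" "inverse (1 + C U) \<le> inverse (1 + C ?W)"
      using inv A U W by auto
  next
    fix U :: "'n fuzzy" assume "U \<in> Fc - {indicator {0}}"
    then have U: "U \<in> Fc" "U \<noteq> indicator {0}" by auto
    have scaled: "filterlim (\<lambda>t. Lnorm r (supp_fun U) * t) at_top at_top"
      by (intro filterlim_tendsto_pos_mult_at_top[OF tendsto_const] Lnorm_supp_fun_pos U r filterlim_ident)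
    have "eventually (\<lambda>t. Lnorm r (supp_fun U) * t = rho r (A \<oplus>\<^sub>F t \<odot>\<^sub>F U) A) at_top"
      using eventually_ge_at_top[of 0] by eventually_elim (simp add: rho_add_scale[OF A U(1) _ r])
    then have "filterlim (\<lambda>t. rho r (A \<oplus>\<^sub>F t \<odot>\<^sub>F U) A) at_top at_top"
      by (rule filterlim_cong[OF refl refl, THEN iffD1]) (rule scaled)
    then show "((\<lambda>t. inverse (1 + C (A \<oplus>\<^sub>F t \<odot>\<^sub>F U))) \<longlongrightarrow> 0) at_top"
      using A U by (intro tendsto0) (auto intro!: always_eventually fuzzy_add_Fc fuzzy_scale_Fc)
  next
    fix s \<theta> :: real and d and U V :: "'n fuzzy"
    assume *: "1 < s" "0 < \<theta>" "d \<in> {rho s, dmetric s \<theta>}" "U \<in> Fc" "V \<in> Fc" "d A V = d A U + d U V"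
    obtain t where "0 \<le> t" "t \<le> 1"
      "AE z in sphere_levels. supp_fun U z = (1 - t) * supp_fun A z + t * supp_fun V z"
      using metric_segment[OF *(1-3) A *(4-6)] by blast
    then have "C A \<le> C U \<and> C U \<le> C V" using * by (intro mono) auto
    then show "inverse (1 + C U) \<le> inverse (1 + C A)" "inverse (1 + C V) \<le> inverse (1 + C U)"
      using inv A * by auto
  next
    fix s \<theta> :: real and d and A' :: "nat \<Rightarrow> 'n fuzzy"
    assume *: "s \<in> {1..r}" "0 < \<theta>" "d \<in> {rho s, dmetric s \<theta>}"
      "(\<forall>n. A' n \<in> Fc) \<and> filterlim (\<lambda>n. d (A' n) A) at_top sequentially"
    then show "(\<lambda>n. inverse (1 + C (A' n))) \<longlonglongrightarrow> 0"
      using A by (intro tendsto0 rho_at_top[of s r \<theta> d]) auto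
  qed
qed

theorem theorem4p21:
  fixes P :: "'w measure"
    and r :: real
    and H1 Hr H :: "('w \<Rightarrow> 'n::finite fuzzy) set"
    and D :: "'n fuzzy \<Rightarrow> ('w \<Rightarrow> 'n fuzzy) \<Rightarrow> real"
    and X :: "'w \<Rightarrow> 'n fuzzy"
    and A :: "'n fuzzy"
  assumes "prob_space P"
    and "1 \<le> r"
    and "H1 \<subseteq> Lr_fuzzy P 1"
    and "Hr \<subseteq> Lr_fuzzy P r"
    and "(D, H) \<in> {(natural_depth P r, H1), (natural_raised_depth P r, Hr)}"
    and "X \<in> H"
    and "A \<in> Fc"
    and "D A X = (SUP B\<in>Fc. D B X)"
  shows
    "(\<forall>t\<in>{0..1}. \<forall>U\<in>Fc.
        D A X \<ge> D ((1 - t) \<odot>\<^sub>F A \<oplus>\<^sub>F t \<odot>\<^sub>F U) X \<and>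
        D ((1 - t) \<odot>\<^sub>F A \<oplus>\<^sub>F t \<odot>\<^sub>F U) X \<ge> D U X)
     \<and> (\<forall>U\<in>Fc - {indicator {0}}. ((\<lambda>t. D (A \<oplus>\<^sub>F t \<odot>\<^sub>F U) X) \<longlongrightarrow> 0) at_top)
     \<and> (\<forall>s>1. \<forall>\<theta>>0. \<forall>d\<in>{rho s, dmetric s \<theta>}. \<forall>U\<in>Fc. \<forall>V\<in>Fc.
        d A V = d A U + d U V \<longrightarrow> D A X \<ge> D U X \<and> D U X \<ge> D V X)
     \<and> (\<forall>s\<in>{1..r}. \<forall>\<theta>>0. \<forall>d\<in>{rho s, dmetric s \<theta>}. \<forall>A' :: nat \<Rightarrow> 'n fuzzy.
        (\<forall>n. A' n \<in> Fc) \<and> filterlim (\<lambda>n. d (A' n) A) at_top sequentially \<longrightarrow>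
        (\<lambda>n. D (A' n) X) \<longlonglongrightarrow> 0)"
proof -
  interpret prob_space P by (rule assms)
  note r = \<open>1 \<le> r\<close> and A = \<open>A \<in> Fc\<close>
  have X1: "X \<in> Lr_fuzzy P 1"
    using assms Lr_fuzzy_subset_L1[OF r \<open>prob_space P\<close>] by auto
  then have XFc: "X \<omega> \<in> Fc" if "\<omega> \<in> space P" for \<omega>
    using that by (auto simp: Lr_fuzzy_def intro: fuzzy_rv_Fc)
  have int1: "integrable P (\<lambda>\<omega>. rho r B (X \<omega>))" if "B \<in> Fc" for B
    using integrable_rho_powr[OF X1 _ r that \<open>prob_space P\<close>] by (simp add: rho_nonneg)
  have coercive1: "rho r B A \<le> (\<integral>\<omega>. rho r B (X \<omega>) \<partial>P) + (\<integral>\<omega>. rho r A (X \<omega>) \<partial>P)" if B: "B \<in> Fc" for B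
  proof -
    have tri: "rho r B A \<le> rho r B (X \<omega>) + rho r A (X \<omega>)" if "\<omega> \<in> space P" for \<omega>
      using rho_triangle[OF r B XFc[OF that] A] by (simp add: rho_commute[of r "X \<omega>" A])
    have "rho r B A = (\<integral>\<omega>. rho r B A \<partial>P)" by (simp add: prob_space)
    also have "\<dots> \<le> (\<integral>\<omega>. rho r B (X \<omega>) + rho r A (X \<omega>) \<partial>P)"
      using int1 A B tri by (intro integral_mono) auto
    also have "\<dots> = (\<integral>\<omega>. rho r B (X \<omega>) \<partial>P) + (\<integral>\<omega>. rho r A (X \<omega>) \<partial>P)"
      using int1 A B by simp
    finally show ?thesis .
  qed
  consider "D = natural_depth P r" | "D = natural_raised_depth P r" "X \<in> Lr_fuzzy P r"
    using assms by auto
  then show ?thesis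
  proof cases
    case 1
    let ?C = "\<lambda>B. \<integral>\<omega>. rho r B (X \<omega>) \<partial>P"
    have D: "D B X = inverse (1 + ?C B)" for B by (simp add: 1 natural_depth_def)
    show ?thesis unfolding D
    proof (rule depth_of_convex_coercive_cost[where K = "?C A"])
      fix A' V W :: "'n fuzzy" and t :: real
      assume *: "A' \<in> Fc" "V \<in> Fc" "W \<in> Fc" "0 \<le> t" "t \<le> 1"
        "AE z in sphere_levels. supp_fun W z = (1 - t) * supp_fun A' z + t * supp_fun V z"
      have "?C W \<le> (\<integral>\<omega>. (1 - t) * rho r A' (X \<omega>) + t * rho r V (X \<omega>) \<partial>P)"
        using * int1 XFc r by (intro integral_mono rho_convex) auto
      then show "?C W \<le> (1 - t) * ?C A' + t * ?C V" using int1 * by simp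
    qed (use r A coercive1 assms(8)[unfolded D] in \<open>auto intro!: integral_nonneg_AE simp: rho_nonneg\<close>)
  next
    case 2
    let ?C = "\<lambda>B. \<integral>\<omega>. rho r B (X \<omega>) powr r \<partial>P"
    have D: "D B X = inverse (1 + ?C B)" for B by (simp add: 2 natural_raised_depth_def)
    have intr: "integrable P (\<lambda>\<omega>. rho r B (X \<omega>) powr r)" if "B \<in> Fc" for B
      using integrable_rho_powr[OF 2(2) r r that \<open>prob_space P\<close>] .
    show ?thesis unfolding D
    proof (rule depth_of_convex_coercive_cost[where K = "1 + (\<integral>\<omega>. rho r A (X \<omega>) \<partial>P)"])
      fix A' V W :: "'n fuzzy" and t :: real
      assume *: "A' \<in> Fc" "V \<in> Fc" "W \<in> Fc" "0 \<le> t" "t \<le> 1"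
        "AE z in sphere_levels. supp_fun W z = (1 - t) * supp_fun A' z + t * supp_fun V z"
      have "rho r W (X \<omega>) powr r \<le> (1 - t) * rho r A' (X \<omega>) powr r + t * rho r V (X \<omega>) powr r"
        if "\<omega> \<in> space P" for \<omega>
      proof -
        have "rho r W (X \<omega>) powr r \<le> ((1 - t) * rho r A' (X \<omega>) + t * rho r V (X \<omega>)) powr r"
          using rho_convex[OF r *(1-3) XFc[OF that] *(4-6)] r by (intro powr_mono2) (auto simp: rho_nonneg)
        also have "\<dots> \<le> (1 - t) * rho r A' (X \<omega>) powr r + t * rho r V (X \<omega>) powr r"
          using abs_powr_convex[OF r *(4,5), of "rho r A' (X \<omega>)" "rho r V (X \<omega>)"] *(4,5)
          by (simp add: rho_nonneg)
        finally show ?thesis .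
      qed
      then have "?C W \<le> (\<integral>\<omega>. (1 - t) * rho r A' (X \<omega>) powr r + t * rho r V (X \<omega>) powr r \<partial>P)"
        using * intr by (intro integral_mono) auto
      then show "?C W \<le> (1 - t) * ?C A' + t * ?C V" using intr * by simp
    next
      fix B :: "'n fuzzy" assume B: "B \<in> Fc"
      (* The raised cost exceeds the plain one up to the constant 1, hence is coercive as well. *)
      have "x \<le> 1 + x powr r" if "0 \<le> x" for x :: real
        using powr_le_one_plus_powr[of 1 r x] r that by simp
      then have "(\<integral>\<omega>. rho r B (X \<omega>) \<partial>P) \<le> (\<integral>\<omega>. 1 + rho r B (X \<omega>) powr r \<partial>P)"
        using int1[OF B] intr[OF B] by (intro integral_mono) (auto simp: rho_nonneg)
      also have "\<dots> = 1 + ?C B" using intr[OF B] by (simp add: prob_space)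
      finally show "rho r B A \<le> ?C B + (1 + (\<integral>\<omega>. rho r A (X \<omega>) \<partial>P))" using coercive1[OF B] by simp
    qed (use r A assms(8)[unfolded D] in \<open>auto intro!: integral_nonneg_AE\<close>)
  qed
qed

end
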